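(* Let $G$ be a finite group and $O'\subset O$ two equipments of $G$, $O=C_1\sqcup\dots\sqcup C_m$ and $O'=C_1\sqcup\dots\sqcup C_k$ ($k\le m$, $C_i$ conjugacy classes of $G$), such that the elements of $O'$ generate $G$. Then there is a constant $T=T_{(O,O')}$ such that if $s_1\in S(G,O)^G$ satisfies $\tau_i(s_1)\ge T$ for all $i=1,\dots,k$, then there are not more than $a_{(G,O')}$ elements $s_1,\dots,s_n\in S(G,O)^G$ such that $s_i\ne s_j$ for $1\le i<j\le n$, $\tau(s_i)=\tau(s_1)$ and $\alpha_G(s_i)=\alpha_G(s_1)$ for $1\le i\le n$.
   Context: An equipment of a group $G$ is a subset $O\subset G$ which is a union of finitely many conjugacy classes, $1\notin O$. The factorization semigroup $S(G,O)$ is generated by symbols $x_g$, $g\in O$, subject to $x_{g_1}x_{g_2}=x_{g_2}x_{g_2^{-1}g_1g_2}=x_{g_1g_2g_1^{-1}}x_{g_1}$ ($g_1,g_2\in O$); $\alpha_G:S(G,O)\to G$, $x_g\mapsto g$. For $s=x_{g_1}\cdots x_{g_n}$, $G_s$ is the subgroup generated by $g_1,\dots,g_n$ (well defined), $S(G,O)^G=\{s:G_s=G\}$. The type $\tau(s)=(\tau_1(s),\dots,\tau_m(s))$ with $\tau_i(s)$ the number of factors $x_g$ of $s$ with $g\in C_i$. Ambiguity index of $(G,O')$ with $O'$ generating $G$: let $\widehat G$ be the group with generators $y_g$ ($g\in O'$) and relations $y_h^{-1}y_gy_h=y_{h^{-1}gh}$ for $g,h\in O'$, $\beta:\widehat G\to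 G$, $y_g\mapsto g$, $H=\ker\beta$; $a_{(G,O')}=|H\cap[\widehat G,\widehat G]|$. *)

theory Defs
  imports "HOL-Algebra.Algebra"
begin

definition conj_class :: "('a, 'b) monoid_scheme \<Rightarrow> 'a \<Rightarrow> 'a set" where
  "conj_class G g = {x \<otimes>\<^bsub>G\<^esub> g \<otimes>\<^bsub>G\<^esub> inv\<^bsub>G\<^esub> x | x. x \<in> carrier G}"

definition conj_classes :: "('a, 'b) monoid_scheme \<Rightarrow> 'a set set" where
  "conj_classes G = {conj_class G g | g. g \<in> carrier G}"

definition equipment :: "('a, 'b) monoid_scheme \<Rightarrow> 'a set \<Rightarrow> bool" where
  "equipment G E \<longleftrightarrow> E \<subseteq> carrier G \<and> \<one>\<^bsub>G\<^esub> \<notin> E \<and>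
     (\<exists>Cs. finite Cs \<and> Cs \<subseteq> conj_classes G \<and> E = \<Union>Cs)"

definition wprod :: "('a, 'b) monoid_scheme \<Rightarrow> 'a list \<Rightarrow> 'a" where
  "wprod G w = foldr (\<lambda>g h. g \<otimes>\<^bsub>G\<^esub> h) w \<one>\<^bsub>G\<^esub>"

inductive_set hstep :: "('a, 'b) monoid_scheme \<Rightarrow> 'a set \<Rightarrow> ('a list \<times> 'a list) set"
  for G E where
  h1: "\<lbrakk>u \<in> lists E; v \<in> lists E; g1 \<in> E; g2 \<in> E\<rbrakk> \<Longrightarrow>
       (u @ [g1, g2] @ v, u @ [g2, inv\<^bsub>G\<^esub> g2 \<otimes>\<^bsub>G\<^esub> g1 \<otimes>\<^bsub>G\<^esub> g2] @ v) \<in> hstep G E"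
| h2: "\<lbrakk>u \<in> lists E; v \<in> lists E; g1 \<in> E; g2 \<in> E\<rbrakk> \<Longrightarrow>
       (u @ [g1, g2] @ v, u @ [g1 \<otimes>\<^bsub>G\<^esub> g2 \<otimes>\<^bsub>G\<^esub> inv\<^bsub>G\<^esub> g1, g1] @ v) \<in> hstep G E"

definition hequiv :: "('a, 'b) monoid_scheme \<Rightarrow> 'a set \<Rightarrow> ('a list \<times> 'a list) set" where
  "hequiv G E = ((hstep G E \<union> converse (hstep G E))\<^sup>* ) \<inter> (lists E \<times> lists E)"

text \<open>Elements of S(G,E): equivalence classes of words (the empty word is the unit).\<close>
definition FS :: "('a, 'b) monoid_scheme \<Rightarrow> 'a set \<Rightarrow> 'a list set set" where
  "FS G E = lists E // hequiv G E"

definition wrep :: "'a list set \<Rightarrow> 'a list" where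
  "wrep SA = (SOME w. w \<in> SA)"

definition alphaG :: "('a, 'b) monoid_scheme \<Rightarrow> 'a list set \<Rightarrow> 'a" where
  "alphaG G SA = wprod G (wrep SA)"

definition Gs :: "('a, 'b) monoid_scheme \<Rightarrow> 'a list set \<Rightarrow> 'a set" where
  "Gs G SA = generate G (set (wrep SA))"

definition FS_full :: "('a, 'b) monoid_scheme \<Rightarrow> 'a set \<Rightarrow> 'a list set set" where
  "FS_full G E = {SA \<in> FS G E. Gs G SA = carrier G}"

definition tau :: "'a list set \<Rightarrow> 'a set \<Rightarrow> nat" where
  "tau SA C = length (filter (\<lambda>g. g \<in> C) (wrep SA))"

text \<open>Words in the generators y_g (True) and their inverses (False), g in E'.\<close>
inductive_set pstep :: "('a, 'b) monoid_scheme \<Rightarrow> 'a set \<Rightarrow>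
    ((bool \<times> 'a) list \<times> (bool \<times> 'a) list) set" for G E' where
  cancel: "\<lbrakk>u \<in> lists (UNIV \<times> E'); v \<in> lists (UNIV \<times> E'); g \<in> E'\<rbrakk> \<Longrightarrow>
       (u @ [(b, g), (\<not> b, g)] @ v, u @ v) \<in> pstep G E'"
| rel: "\<lbrakk>u \<in> lists (UNIV \<times> E'); v \<in> lists (UNIV \<times> E'); g \<in> E'; h \<in> E'\<rbrakk> \<Longrightarrow>
       (u @ [(False, h), (True, g), (True, h)] @ v,
        u @ [(True, inv\<^bsub>G\<^esub> h \<otimes>\<^bsub>G\<^esub> g \<otimes>\<^bsub>G\<^esub> h)] @ v) \<in> pstep G E'"

definition pequiv :: "('a, 'b) monoid_scheme \<Rightarrow> 'a set \<Rightarrow>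
    ((bool \<times> 'a) list \<times> (bool \<times> 'a) list) set" where
  "pequiv G E' = ((pstep G E' \<union> converse (pstep G E'))\<^sup>* ) \<inter>
                  (lists (UNIV \<times> E') \<times> lists (UNIV \<times> E'))"

definition hatG :: "('a, 'b) monoid_scheme \<Rightarrow> 'a set \<Rightarrow> (bool \<times> 'a) list set monoid" where
  "hatG G E' = \<lparr> carrier = lists (UNIV \<times> E') // pequiv G E',
                 monoid.mult = (\<lambda>SA SB. pequiv G E' `` {wrep SA @ wrep SB}),
                 one = pequiv G E' `` {[]} \<rparr>"

definition letter_val :: "('a, 'b) monoid_scheme \<Rightarrow> bool \<times> 'a \<Rightarrow> 'a" where
  "letter_val G l = (if fst l then snd l else inv\<^bsub>G\<^esub> (snd l))"

definition betaG :: "('a, 'b) monoid_scheme \<Rightarrow> (bool \<times> 'a) list set \<Rightarrow> 'a" where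
  "betaG G SA = wprod G (map (letter_val G) (wrep SA))"

definition amb_set :: "('a, 'b) monoid_scheme \<Rightarrow> 'a set \<Rightarrow> (bool \<times> 'a) list set set" where
  "amb_set G E' = {SA \<in> derived (hatG G E') (carrier (hatG G E')). betaG G SA = \<one>\<^bsub>G\<^esub>}"

end

theory Submission
  imports Defs
begin

text \<open>Let \<open>N = |G|\<close>. The word \<open>g\<^sup>N\<close> is
  central, and in front of a word generating \<open>G\<close> it may be replaced by any conjugate \<open>h\<^sup>N\<close>. By the
  pigeonhole principle a generating word with many letters in the class of \<open>g\<close> therefore factors as
  \<open>g\<^sup>N w\<close> with \<open>w\<close> still generating.

  Consequently a generating word with many letters from each class of \<open>O'\<close> equals \<open>w r\<close> with \<open>w\<close> a
  generating word over \<open>O'\<close> and \<open>r\<close> a word over the remaining classes; the generating words over \<open>O'\<close>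
  allow one to conjugate the letters of \<open>r\<close> independently, so \<open>r\<close> may be prescribed by its type. The
  elements to be counted are thus given by the possible \<open>w\<close>, all of the same type and product.

  Multiplying by \<open>g\<^sup>N\<close> is surjective on generating words of large type, so the number of
  elements of a given type is eventually constant along residue classes of types modulo \<open>N\<close>, and
  then these multiplications are bijective. The group of \<open>(G,O')\<close> is the localization of
  \<open>S(G,O')\<close> at the central word \<open>\<Omega> = \<Prod> g\<^sup>N\<close>, \<open>g \<in> O'\<close>, hence \<open>w\<close> is determined by its image in
  that group. Two images differ by an element of the commutator subgroup that maps to \<open>1\<close> in \<open>G\<close>.\<close>

section \<open>Letter counts, products of words and conjugation\<close>

definition cnt :: "'a set \<Rightarrow> 'a list \<Rightarrow> nat" where
  "cnt C w = length (filter (\<lambda>g. g \<in> C) w)"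

lemma cnt_simps [simp]:
  "cnt C [] = 0"
  "cnt C (x # w) = (if x \<in> C then 1 else 0) + cnt C w"
  "cnt C (u @ w) = cnt C u + cnt C w"
  by (auto simp: cnt_def)

lemma cnt_replicate: "cnt C (replicate n g) = (if g \<in> C then n else 0)"
  by (induction n) auto

lemma cnt_eq_0: "set w \<inter> C = {} \<Longrightarrow> cnt C w = 0"
  by (induction w) auto

lemma wprod_simps [simp]:
  "wprod G [] = \<one>\<^bsub>G\<^esub>"
  "wprod G (g # w) = g \<otimes>\<^bsub>G\<^esub> wprod G w"
  by (auto simp: wprod_def)

text \<open>The left conjugation action. With it the two defining relations read
  \<open>g h = h (cj G (inv h) g)\<close> and \<open>g h = (cj G g h) g\<close>.\<close>

definition cj :: "('a, 'b) monoid_scheme \<Rightarrow> 'a \<Rightarrow> 'a \<Rightarrow> 'a" where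
  "cj G x g = x \<otimes>\<^bsub>G\<^esub> g \<otimes>\<^bsub>G\<^esub> inv\<^bsub>G\<^esub> x"

definition full :: "('a, 'b) monoid_scheme \<Rightarrow> 'a list \<Rightarrow> bool" where
  "full G w \<longleftrightarrow> generate G (set w) = carrier G"

context group
begin

lemma wprod_closed [simp, intro]: "w \<in> lists (carrier G) \<Longrightarrow> wprod G w \<in> carrier G"
  by (induction w) auto

lemma wprod_append:
  "u \<in> lists (carrier G) \<Longrightarrow> w \<in> lists (carrier G) \<Longrightarrow> wprod G (u @ w) = wprod G u \<otimes> wprod G w"
  by (induction u) (auto simp: m_assoc)

lemma wprod_replicate: "g \<in> carrier G \<Longrightarrow> wprod G (replicate n g) = g [^] n"
  by (induction n) (auto simp: nat_pow_Suc2[symmetric] simp del: nat_pow_Suc)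

lemma cj_closed [simp, intro]: "x \<in> carrier G \<Longrightarrow> g \<in> carrier G \<Longrightarrow> cj G x g \<in> carrier G"
  by (simp add: cj_def)

lemma cj_cj: "x \<in> carrier G \<Longrightarrow> y \<in> carrier G \<Longrightarrow> g \<in> carrier G \<Longrightarrow> cj G x (cj G y g) = cj G (x \<otimes> y) g"
  by (simp add: cj_def m_assoc inv_mult_group)

lemma cj_one [simp]: "g \<in> carrier G \<Longrightarrow> cj G \<one> g = g"
  by (simp add: cj_def)

lemma cj_self [simp]: "g \<in> carrier G \<Longrightarrow> cj G g g = g"
  by (simp add: cj_def m_assoc)

lemma cj_inv_cj [simp]:
  "x \<in> carrier G \<Longrightarrow> g \<in> carrier G \<Longrightarrow> cj G (inv x) (cj G x g) = g"
  "x \<in> carrier G \<Longrightarrow> g \<in> carrier G \<Longrightarrow> cj G x (cj G (inv x) g) = g"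
  by (simp_all add: cj_cj)

lemma cj_inv_self [simp]: "g \<in> carrier G \<Longrightarrow> cj G (inv g) g = g"
  using cj_inv_cj(1)[of g g] by simp

lemma cj_mult_left: "x \<in> carrier G \<Longrightarrow> g \<in> carrier G \<Longrightarrow> cj G x g \<otimes> x = x \<otimes> g"
  by (simp add: cj_def m_assoc)

lemma conj_class_eq: "conj_class G g = (\<lambda>x. cj G x g) ` carrier G"
  by (auto simp: conj_class_def cj_def)

lemma conj_class_self [simp]: "g \<in> carrier G \<Longrightarrow> g \<in> conj_class G g"
  unfolding conj_class_eq by (rule image_eqI[of _ _ \<one>]) auto

lemma conj_class_in: "g \<in> carrier G \<Longrightarrow> conj_class G g \<in> conj_classes G"
  by (auto simp: conj_classes_def)

lemma conj_classes_sub: "C \<in> conj_classes G \<Longrightarrow> C \<subseteq> carrier G"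
  by (auto simp: conj_classes_def conj_class_eq)

lemma conj_classes_cj:
  assumes "C \<in> conj_classes G" "x \<in> carrier G" "g \<in> carrier G"
  shows "cj G x g \<in> C \<longleftrightarrow> g \<in> C"
proof -
  obtain a where a: "a \<in> carrier G" "C = (\<lambda>y. cj G y a) ` carrier G"
    using assms(1) by (auto simp: conj_classes_def conj_class_eq)
  have *: "cj G y h \<in> C" if "h \<in> C" "y \<in> carrier G" for y h
    using that a by (auto simp: cj_cj)
  show ?thesis
    using *[of "cj G x g" "inv x"] *[of g x] assms by auto
qed

lemma conj_classes_transitive:
  assumes "C \<in> conj_classes G" "g \<in> C" "h \<in> C"
  obtains c where "c \<in> carrier G" "h = cj G c g"
proof -
  obtain a x y where *: "a \<in> carrier G" "x \<in> carrier G" "y \<in> carrier G" "g = cj G x a" "h = cj G y a"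
    using assms by (auto simp: conj_classes_def conj_class_eq)
  have "h = cj G (y \<otimes> inv x) g"
    using * by (simp add: cj_cj m_assoc)
  then show ?thesis using * that[of "y \<otimes> inv x"] by simp
qed

lemma conj_class_eqI:
  assumes "C \<in> conj_classes G" "g \<in> C"
  shows "conj_class G g = C"
proof
  have g: "g \<in> carrier G" using assms conj_classes_sub by blast
  show "conj_class G g \<subseteq> C"
    using assms g by (auto simp: conj_class_eq conj_classes_cj)
  show "C \<subseteq> conj_class G g"
  proof
    fix h assume "h \<in> C"
    then show "h \<in> conj_class G g"
      using conj_classes_transitive[OF assms] by (metis conj_class_eq imageI)
  qed
qed

text \<open>In a finite group \<open>inv x\<close> is a power of \<open>x\<close>, so a subset
  containing the unit and closed under products is already a subgroup. Later inductions over a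
  generated group therefore never treat inverses.\<close>

lemma finite_generate_induct:
  assumes fin: "finite (carrier G)" and "H \<subseteq> A" "A \<subseteq> carrier G" "\<one> \<in> A"
    and mult: "\<And>x y. x \<in> A \<Longrightarrow> y \<in> A \<Longrightarrow> x \<otimes> y \<in> A"
  shows "generate G H \<subseteq> A"
proof
  have pow: "x [^] (n::nat) \<in> A" if "x \<in> A" for x n
    using that assms by (induction n) auto
  have inv: "inv x \<in> A" if "x \<in> A" for x
  proof -
    have x: "x \<in> carrier G" using that assms by auto
    have "order G > 0" using fin by (simp add: order_gt_0_iff_finite)
    then obtain m where m: "order G = Suc m" by (cases "order G") auto
    have "x [^] m \<otimes> x = \<one>"
      using pow_order_eq_1[OF x] by (simp add: m)
    then have "x [^] m = inv x"
      using x by (metis inv_equality nat_pow_closed)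
    then show ?thesis using pow[OF that] by metis
  qed
  fix x assume "x \<in> generate G H"
  then show "x \<in> A"
    by (induction rule: generate.induct) (use assms inv in auto)
qed

end

section \<open>The factorization semigroup of a conjugation-invariant subset of a finite
  group\<close>

locale conj_closed = group G for G (structure) +
  fixes E
  assumes fin: "finite (carrier G)"
    and sub: "E \<subseteq> carrier G"
    and cjE [simp, intro]: "x \<in> carrier G \<Longrightarrow> g \<in> E \<Longrightarrow> cj G x g \<in> E"
begin

lemma carr [simp, intro]: "g \<in> E \<Longrightarrow> g \<in> carrier G"
  using sub by auto

lemma carr_lists [simp, intro]: "w \<in> lists E \<Longrightarrow> w \<in> lists (carrier G)"
  using sub by auto

lemma finE: "finite E"
  using sub fin finite_subset by blast

definition eqv (infix "\<doteq>" 50) where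
  "u \<doteq> v \<longleftrightarrow> (u, v) \<in> hequiv G E"

lemma hstep_cases [consumes 1, case_names right left]:
  assumes "(x, y) \<in> hstep G E"
  obtains u v g h where "u \<in> lists E" "v \<in> lists E" "g \<in> E" "h \<in> E"
      "x = u @ [g, h] @ v" "y = u @ [h, cj G (inv h) g] @ v"
    | u v g h where "u \<in> lists E" "v \<in> lists E" "g \<in> E" "h \<in> E"
      "x = u @ [g, h] @ v" "y = u @ [cj G g h, g] @ v"
  using assms by (cases rule: hstep.cases) (auto simp: cj_def)

lemma hstep_lists: "(u, v) \<in> hstep G E \<Longrightarrow> u \<in> lists E \<and> v \<in> lists E"
  by (cases rule: hstep_cases) auto

lemma eqv_lists: "u \<doteq> v \<Longrightarrow> u \<in> lists E \<and> v \<in> lists E"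
  by (auto simp: eqv_def hequiv_def)

lemma eqv_refl [simp, intro]: "u \<in> lists E \<Longrightarrow> u \<doteq> u"
  by (auto simp: eqv_def hequiv_def)

lemma eqv_sym: "u \<doteq> v \<Longrightarrow> v \<doteq> u"
proof -
  have "sym ((hstep G E \<union> converse (hstep G E))\<^sup>*)"
    by (intro sym_rtrancl) (auto simp: sym_def)
  then show "u \<doteq> v \<Longrightarrow> v \<doteq> u"
    by (auto simp: eqv_def hequiv_def sym_def)
qed

lemma eqv_trans [trans]: "u \<doteq> v \<Longrightarrow> v \<doteq> w \<Longrightarrow> u \<doteq> w"
  by (auto simp: eqv_def hequiv_def)

lemma equiv_hequiv: "equiv (lists E) (hequiv G E)"
proof (rule equivI)
  show "hequiv G E \<subseteq> lists E \<times> lists E" by (auto simp: hequiv_def)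
  show "refl_on (lists E) (hequiv G E)" by (auto simp: refl_on_def hequiv_def)
  show "sym (hequiv G E)" using eqv_sym by (auto simp: sym_def eqv_def)
  show "trans (hequiv G E)" using eqv_trans unfolding trans_def eqv_def by blast
qed

lemma hstep_eqv: "(u, v) \<in> hstep G E \<Longrightarrow> u \<doteq> v"
  using hstep_lists by (auto simp: eqv_def hequiv_def)

text \<open>For invariants: when \<open>P\<close> is itself an equivalence relation, such as
  equality of some value, only single moves have to be checked.\<close>

lemma eqv_induct [consumes 1, case_names refl sym trans step]:
  assumes "u \<doteq> v"
    and "\<And>u. P u u" "\<And>u v. P u v \<Longrightarrow> P v u" "\<And>u v w. P u v \<Longrightarrow> P v w \<Longrightarrow> P u w"
    and "\<And>u v. (u, v) \<in> hstep G E \<Longrightarrow> P u v"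
  shows "P u v"
proof -
  have "(u, v) \<in> (hstep G E \<union> converse (hstep G E))\<^sup>*"
    using assms(1) by (auto simp: eqv_def hequiv_def)
  then show ?thesis
    by (induction rule: rtrancl_induct) (use assms(2-) in blast)+
qed

lemma hstep_cong:
  assumes "(u, v) \<in> hstep G E" "a \<in> lists E" "b \<in> lists E"
  shows "(a @ u @ b, a @ v @ b) \<in> hstep G E"
  using assms
proof (induction rule: hstep.induct)
  case (h1 u v g1 g2)
  then show ?case using hstep.h1[of "a @ u" E "v @ b" g1 g2 G] by simp
next
  case (h2 u v g1 g2)
  then show ?case using hstep.h2[of "a @ u" E "v @ b" g1 g2 G] by simp
qed

lemma eqv_cong:
  assumes "u \<doteq> v" "a \<in> lists E" "b \<in> lists E"
  shows "a @ u @ b \<doteq> a @ v @ b"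
proof -
  have "(u, v) \<in> (hstep G E \<union> converse (hstep G E))\<^sup>*"
    using assms(1) by (auto simp: eqv_def hequiv_def)
  then have "(a @ u @ b, a @ v @ b) \<in> (hstep G E \<union> converse (hstep G E))\<^sup>*"
  proof (induction rule: rtrancl_induct)
    case (step y z)
    moreover from step(2) have "(a @ y @ b, a @ z @ b) \<in> hstep G E \<union> converse (hstep G E)"
      using assms(2,3) hstep_cong by blast
    ultimately show ?case
      by (meson rtrancl_into_rtrancl)
  qed simp
  then show ?thesis
    using assms eqv_lists[OF assms(1)] by (simp add: eqv_def hequiv_def)
qed

lemma eqv_append_left: "u \<doteq> v \<Longrightarrow> a \<in> lists E \<Longrightarrow> a @ u \<doteq> a @ v"
  using eqv_cong[of u v a "[]"] by simp

lemma eqv_append_right: "u \<doteq> v \<Longrightarrow> b \<in> lists E \<Longrightarrow> u @ b \<doteq> v @ b"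
  using eqv_cong[of u v "[]" b] by simp

lemma eqv_append: "u \<doteq> u' \<Longrightarrow> v \<doteq> v' \<Longrightarrow> u @ v \<doteq> u' @ v'"
  using eqv_append_right[of u u' v] eqv_append_left[of v v' u'] eqv_trans eqv_lists by blast

lemma wprod_eqv: "u \<doteq> v \<Longrightarrow> wprod G u = wprod G v"
proof (induction "u" "v" rule: eqv_induct)
  case (step x y)
  then show ?case
  proof (cases rule: hstep_cases)
    case (right u v g h)
    have "h \<otimes> (cj G (inv h) g \<otimes> wprod G v) = g \<otimes> (h \<otimes> wprod G v)"
      using right cj_mult_left[of h "cj G (inv h) g"] by (simp add: m_assoc[symmetric])
    then show ?thesis using right by (simp add: wprod_append)
  next
    case (left u v g h)
    have "cj G g h \<otimes> (g \<otimes> wprod G v) = g \<otimes> (h \<otimes> wprod G v)"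
      using left cj_mult_left[of g h] by (simp add: m_assoc[symmetric])
    then show ?thesis using left by (simp add: wprod_append)
  qed
qed auto

lemma cnt_eqv: "u \<doteq> v \<Longrightarrow> C \<in> conj_classes G \<Longrightarrow> cnt C u = cnt C v"
proof (induction "u" "v" rule: eqv_induct)
  case (step x y)
  from step(1) show ?case
    by (cases rule: hstep_cases) (use step(2) in \<open>auto simp: conj_classes_cj\<close>)
qed auto

lemma generate_sub: "A \<subseteq> generate G B \<Longrightarrow> B \<subseteq> carrier G \<Longrightarrow> generate G A \<subseteq> generate G B"
  by (meson generate_is_subgroup generate_subgroup_incl)

lemma generate_cj:
  "A \<subseteq> carrier G \<Longrightarrow> x \<in> generate G A \<Longrightarrow> g \<in> generate G A \<Longrightarrow> cj G x g \<in> generate G A"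
  unfolding cj_def by (rule generate.eng[OF generate.eng generate_m_inv_closed])

text \<open>Each of the two letter sets lies in the group generated by the other, because
  \<open>h\<close> is recovered from \<open>cj G g h\<close> through conjugation by
  \<open>inv g\<close>.\<close>

lemma generate_cj_letters:
  assumes "u \<in> lists E" "v \<in> lists E" "g \<in> E" "h \<in> E"
  shows "generate G (set (u @ [cj G g h, g] @ v)) = generate G (set (u @ [g, h] @ v))"
proof -
  let ?A = "set (u @ [g, h] @ v)" and ?B = "set (u @ [cj G g h, g] @ v)"
  have A: "?A \<subseteq> carrier G" and B: "?B \<subseteq> carrier G" using assms by auto
  have "cj G g h \<in> generate G ?A"
    by (intro generate_cj A generate.incl) simp_all
  then have 1: "?B \<subseteq> generate G ?A" by (auto intro: generate.incl)
  have "inv g \<in> generate G ?B"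
    by (intro generate_m_inv_closed[OF B] generate.incl) simp
  then have "cj G (inv g) (cj G g h) \<in> generate G ?B"
    by (rule generate_cj[OF B]) (simp add: generate.incl)
  then have "h \<in> generate G ?B" using assms by simp
  then have 2: "?A \<subseteq> generate G ?B" by (auto intro: generate.incl)
  show ?thesis
    using generate_sub[OF 1 A] generate_sub[OF 2 B] by blast
qed

lemma generate_eqv: "u \<doteq> v \<Longrightarrow> generate G (set u) = generate G (set v)"
proof (induction "u" "v" rule: eqv_induct)
  case (step x y)
  then show ?case
  proof (cases rule: hstep_cases)
    case (right u v g h)
    \<comment> \<open>The right move is a left move on \<open>h\<close> and
      \<open>cj G (inv h) g\<close> read backwards, so the preceding lemma covers it too.\<close>
    have "set x = set (u @ [cj G h (cj G (inv h) g), h] @ v)"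
      "set y = set (u @ [h, cj G (inv h) g] @ v)"
      using right by auto
    then show ?thesis using generate_cj_letters[of u v h "cj G (inv h) g"] right by auto
  next
    case (left u v g h)
    then show ?thesis using generate_cj_letters[of u v g h] by simp
  qed
qed auto

lemma full_eqv: "u \<doteq> v \<Longrightarrow> full G u \<longleftrightarrow> full G v"
  using generate_eqv by (simp add: full_def)

lemma full_mono:
  assumes "full G u" "set u \<subseteq> generate G (set v)" "v \<in> lists E"
  shows "full G v"
proof -
  have v: "set v \<subseteq> carrier G" using assms by auto
  show ?thesis
    using assms(1) generate_sub[OF assms(2) v] generate_incl[OF v] by (auto simp: full_def)
qed

lemma full_superset: "full G u \<Longrightarrow> set u \<subseteq> set v \<Longrightarrow> v \<in> lists E \<Longrightarrow> full G v"
  using full_mono[of u v] by (auto intro: generate.incl)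

lemma swap_left: "g \<in> E \<Longrightarrow> h \<in> E \<Longrightarrow> [g, h] \<doteq> [cj G g h, g]"
  using hstep.h2[of "[]" E "[]" g h G] by (auto simp: cj_def intro: hstep_eqv)

lemma swap_right: "g \<in> E \<Longrightarrow> h \<in> E \<Longrightarrow> [g, h] \<doteq> [h, cj G (inv h) g]"
  using hstep.h1[of "[]" E "[]" g h G] by (auto simp: cj_def intro: hstep_eqv)

text \<open>The moving letter absorbs all conjugations: it passes the letters of \<open>w\<close>
  one by one, each stays as it is, and the conjugations compose to the one by the product of
  \<open>w\<close>.\<close>

lemma move_left: "w \<in> lists E \<Longrightarrow> g \<in> E \<Longrightarrow> w @ [g] \<doteq> cj G (wprod G w) g # w"
proof (induction w)
  case (Cons a w)
  have "(a # w) @ [g] \<doteq> [a] @ ([cj G (wprod G w) g] @ w)"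
    using Cons eqv_append[of "[a]" "[a]" "w @ [g]"] by auto
  also have "\<dots> = [a, cj G (wprod G w) g] @ w" by simp
  also have "\<dots> \<doteq> [cj G a (cj G (wprod G w) g), a] @ w"
    using Cons by (intro eqv_append_right swap_left) auto
  finally show ?case using Cons by (simp add: cj_cj)
qed auto

lemma move_right: "w \<in> lists E \<Longrightarrow> g \<in> E \<Longrightarrow> g # w \<doteq> w @ [cj G (inv (wprod G w)) g]"
  using eqv_sym[OF move_left[of w "cj G (inv (wprod G w)) g"]] by auto

text \<open>The complementary way of moving: here the moving letter is unchanged and the letters it
  passes are conjugated.\<close>

lemma pass_left: "w \<in> lists E \<Longrightarrow> g \<in> E \<Longrightarrow> w @ [g] \<doteq> g # map (cj G (inv g)) w"
proof (induction w)
  case (Cons a w)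
  have "(a # w) @ [g] \<doteq> [a] @ ([g] @ map (cj G (inv g)) w)"
    using Cons eqv_append[of "[a]" "[a]" "w @ [g]"] by auto
  also have "\<dots> = [a, g] @ map (cj G (inv g)) w" by simp
  also have "\<dots> \<doteq> [g, cj G (inv g) a] @ map (cj G (inv g)) w"
    using Cons by (intro eqv_append_right swap_right) auto
  finally show ?case by simp
qed auto

lemma pass_right:
  assumes "w \<in> lists E" "g \<in> E"
  shows "g # w \<doteq> map (cj G g) w @ [g]"
proof -
  have "map (cj G (inv g)) (map (cj G g) w) = w"
    using assms by (induction w) auto
  moreover have "map (cj G g) w @ [g] \<doteq> g # map (cj G (inv g)) (map (cj G g) w)"
    using assms by (intro pass_left) auto
  ultimately show ?thesis using eqv_sym by simp
qed

text \<open>By \<open>move_left\<close> a letter passing a word of product 1 is conjugated by 1, and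
  the word is unchanged.\<close>

lemma central: "w \<in> lists E \<Longrightarrow> wprod G w = \<one> \<Longrightarrow> v \<in> lists E \<Longrightarrow> w @ v \<doteq> v @ w"
proof (induction v)
  case (Cons a v)
  have "w @ [a] \<doteq> [a] @ w" using move_left[of w a] Cons by auto
  then have "(w @ [a]) @ v \<doteq> ([a] @ w) @ v" using Cons by (intro eqv_append_right) auto
  also have "\<dots> = [a] @ (w @ v)" by simp
  also have "\<dots> \<doteq> [a] @ (v @ w)" using Cons by (intro eqv_append_left) auto
  finally show ?case by simp
qed auto

text \<open>Bring the copies of \<open>g\<close> to the front one after another with
  \<open>pass_left\<close>.\<close>

lemma gather:
  assumes "w \<in> lists E" "g \<in> E" "cnt {g} w \<ge> m"
  shows "\<exists>w'. w \<doteq> replicate m g @ w'"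
  using assms
proof (induction m arbitrary: w)
  case 0
  then show ?case by auto
next
  case (Suc m)
  then have "set w \<inter> {g} \<noteq> {}" using cnt_eq_0[of w "{g}"] by force
  then have "g \<in> set w" by blast
  then obtain a b where w: "w = a @ g # b" by (meson split_list)
  let ?a = "map (cj G (inv g)) a"
  \<comment> \<open>Conjugation by \<open>inv g\<close> fixes \<open>g\<close> and no other letter
    becomes \<open>g\<close>, so no copy of \<open>g\<close> is lost or gained among the passed
    letters.\<close>
  have "cnt {g} (map (cj G (inv g)) u) = cnt {g} u" if "u \<in> lists E" for u
    using that
  proof (induction u)
    case (Cons x u)
    have "cj G (inv g) x = g \<longleftrightarrow> x = g"
    proof
      assume "cj G (inv g) x = g"
      then have "cj G g (cj G (inv g) x) = cj G g g" by simp
      then show "x = g" using Cons \<open>g \<in> E\<close> by simp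
    qed (use \<open>g \<in> E\<close> in simp)
    then show ?case using Cons by simp
  qed simp
  then have c: "cnt {g} ?a = cnt {g} a" using Suc w by simp
  have "(a @ [g]) @ b \<doteq> (g # ?a) @ b"
    using Suc w by (intro eqv_append_right pass_left) auto
  then have 1: "w \<doteq> [g] @ (?a @ b)" by (simp add: w)
  have "\<exists>w'. ?a @ b \<doteq> replicate m g @ w'"
    using Suc w c by (intro Suc.IH) auto
  then obtain w' where "?a @ b \<doteq> replicate m g @ w'" by blast
  then have "[g] @ (?a @ b) \<doteq> [g] @ (replicate m g @ w')"
    using Suc by (intro eqv_append_left) auto
  then show ?case using eqv_trans[OF 1] by auto
qed

section \<open>Central powers\<close>

abbreviation N where "N \<equiv> order G"

lemma N_pos: "N > 0"
  using fin by (simp add: order_gt_0_iff_finite)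

text \<open>The \<open>N\<close>-th power of the generator belonging to \<open>g\<close>. As
  \<open>N\<close> is the order of the group, its product is 1 and it is central.\<close>

definition Z where "Z g = replicate N g"

lemma Z_lists [simp, intro]: "g \<in> E \<Longrightarrow> Z g \<in> lists E"
  by (auto simp: Z_def)

lemma set_Z [simp]: "set (Z g) = {g}"
  using N_pos by (auto simp: Z_def)

lemma wprod_Z [simp]: "g \<in> carrier G \<Longrightarrow> wprod G (Z g) = \<one>"
  by (simp add: Z_def wprod_replicate pow_order_eq_1)

lemma cnt_Z: "cnt C (Z g) = (if g \<in> C then N else 0)"
  by (simp add: Z_def cnt_replicate)

text \<open>Being central, \<open>Z g\<close> can be placed directly behind the letter
  \<open>h\<close> of \<open>w\<close>. Moving \<open>h\<close> across it conjugates every letter of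
  \<open>Z g\<close> by \<open>h\<close>, and the resulting central block returns to the
  front.\<close>

lemma Z_conj_letter:
  assumes "w \<in> lists E" "h \<in> set w" "g \<in> E"
  shows "Z g @ w \<doteq> Z (cj G h g) @ w"
proof -
  obtain a b where w: "w = a @ [h] @ b" using split_list[OF assms(2)] by auto
  have ab: "a \<in> lists E" "b \<in> lists E" "h \<in> E" using assms w by auto
  have m: "map (cj G h) (Z g) = Z (cj G h g)" by (simp add: Z_def)
  have "Z g @ w \<doteq> w @ Z g" using assms by (intro central) auto
  also have "\<dots> = (a @ [h]) @ (b @ Z g)" by (simp add: w)
  also have "\<dots> \<doteq> (a @ [h]) @ (Z g @ b)"
    using assms ab by (intro eqv_append_left eqv_sym[OF central]) auto
  also have "\<dots> = a @ (h # Z g) @ b" by simp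
  also have "\<dots> \<doteq> a @ (map (cj G h) (Z g) @ [h]) @ b"
    using assms ab by (intro eqv_cong pass_right) auto
  also have "\<dots> = (a @ Z (cj G h g)) @ [h] @ b" by (simp add: m)
  also have "\<dots> \<doteq> (Z (cj G h g) @ a) @ [h] @ b"
    using assms ab by (intro eqv_append_right eqv_sym[OF central]) auto
  finally show ?thesis by (simp add: w)
qed

lemma Z_conj:
  assumes "w \<in> lists E" "full G w" "g \<in> E" "c \<in> carrier G"
  shows "Z g @ w \<doteq> Z (cj G c g) @ w"
proof -
  \<comment> \<open>The conjugators are required to work for all letters simultaneously; this makes
    the set closed under products.\<close>
  let ?A = "{c \<in> carrier G. \<forall>g\<in>E. Z g @ w \<doteq> Z (cj G c g) @ w}"
  have "generate G (set w) \<subseteq> ?A"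
  proof (rule finite_generate_induct[OF fin])
    show "set w \<subseteq> ?A" using assms Z_conj_letter by auto
    fix x y assume *: "x \<in> ?A" "y \<in> ?A"
    have "Z g @ w \<doteq> Z (cj G (x \<otimes> y) g) @ w" if "g \<in> E" for g
    proof -
      have "Z g @ w \<doteq> Z (cj G y g) @ w" using * that by auto
      also have "\<dots> \<doteq> Z (cj G x (cj G y g)) @ w" using * that by auto
      finally show ?thesis using * that by (simp add: cj_cj)
    qed
    then show "x \<otimes> y \<in> ?A" using * by auto
  qed (use assms in auto)
  then show ?thesis using assms by (auto simp: full_def)
qed

text \<open>One copy of \<open>g\<close> left in \<open>w'\<close> generates everything that the
  removed block contributed.\<close>

lemma full_Z_append:
  assumes "w \<doteq> Z g @ w'" "g \<in> set w'" "full G w"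
  shows "full G w'"
proof -
  have "full G (Z g @ w')" using assms full_eqv by blast
  then show ?thesis
    using full_superset[of "Z g @ w'" w'] assms eqv_lists[of w "Z g @ w'"] by auto
qed

lemma cnt_eq_sum: "finite C \<Longrightarrow> cnt C w = (\<Sum>g\<in>C. cnt {g} w)"
  by (induction w) (auto simp: sum.distrib)

text \<open>The class of \<open>g\<close> has at most \<open>N\<close> elements, so more than
  \<open>N * N\<close> letters from it include some \<open>g'\<close> more than \<open>N\<close>
  times. Its block \<open>Z g'\<close> is then exchanged for \<open>Z g\<close> by
  \<open>Z_conj\<close>.\<close>

lemma extract_Z:
  assumes "w \<in> lists E" "full G w" "g \<in> E" "cnt (conj_class G g) w > N * N"
  shows "\<exists>w'. w' \<in> lists E \<and> full G w' \<and> w \<doteq> Z g @ w'"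
proof -
  let ?C = "conj_class G g"
  have C: "?C \<in> conj_classes G" "?C \<subseteq> E" "g \<in> ?C" "finite ?C"
    using assms conj_class_in[of g] conj_class_self[of g] fin by (auto simp: conj_class_eq)
  have "\<exists>g'\<in>?C. cnt {g'} w > N"
  proof (rule ccontr)
    assume "\<not> ?thesis"
    then have "cnt ?C w \<le> card ?C * N"
      unfolding cnt_eq_sum[OF C(4)] by (metis (mono_tags, lifting) not_less of_nat_id sum_bounded_above)
    also have "\<dots> \<le> N * N"
      using C fin conj_classes_sub by (auto simp: order_def intro!: card_mono)
    finally show False using assms by simp
  qed
  \<comment> \<open>\<open>N\<close> copies of \<open>g'\<close> form the block and one more stays
    behind, which keeps the remainder full.\<close>
  then obtain g' where g': "g' \<in> ?C" "cnt {g'} w \<ge> Suc N" by auto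
  then obtain v where "w \<doteq> replicate (Suc N) g' @ v"
    using gather[of w g' "Suc N"] assms C by auto
  moreover have "replicate (Suc N) g' @ v = Z g' @ g' # v"
    by (simp add: Z_def replicate_append_same)
  ultimately have 1: "w \<doteq> Z g' @ (g' # v)" by metis
  have 2: "full G (g' # v)" using full_Z_append[OF 1] assms by auto
  have 3: "g' # v \<in> lists E" using eqv_lists[OF 1] by auto
  obtain c where "c \<in> carrier G" "g = cj G c g'"
    using conj_classes_transitive[OF C(1) g'(1) C(3)] by blast
  then have "Z g' @ (g' # v) \<doteq> Z g @ (g' # v)" using Z_conj[OF 3 2] g' C by auto
  with 1 2 3 eqv_trans show ?thesis by blast
qed

definition Zs where "Zs gs = concat (map Z gs)"

lemma Zs_simps [simp]: "Zs [] = []" "Zs (g # gs) = Z g @ Zs gs" "Zs (gs @ hs) = Zs gs @ Zs hs"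
  by (auto simp: Zs_def)

lemma Zs_lists [simp, intro]: "gs \<in> lists E \<Longrightarrow> Zs gs \<in> lists E"
  by (induction gs) auto

lemma wprod_Zs [simp]: "gs \<in> lists E \<Longrightarrow> wprod G (Zs gs) = \<one>"
  by (induction gs) (auto simp: wprod_append)

lemma set_Zs [simp]: "set (Zs gs) = set gs"
  by (induction gs) auto

lemma cnt_Zs_dvd: "N dvd cnt C (Zs gs)"
  by (induction gs) (auto simp: cnt_Z)

text \<open>Blocks are split off successively. The hypothesis reserves the letters consumed by all
  blocks, so more than \<open>N * N\<close> are still present whenever \<open>extract_Z\<close> is
  applied.\<close>

lemma extract_Zs:
  assumes "w \<in> lists E" "full G w" "gs \<in> lists E"
    "\<forall>g\<in>set gs. cnt (conj_class G g) w > N * N + cnt (conj_class G g) (Zs gs)"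
  shows "\<exists>w'. w' \<in> lists E \<and> full G w' \<and> w \<doteq> Zs gs @ w'"
  using assms
proof (induction gs arbitrary: w rule: list.induct)
  case (Cons g gs)
  then obtain w1 where w1: "w1 \<in> lists E" "full G w1" "w \<doteq> Z g @ w1"
    using extract_Z[of w g] by auto
  have "\<exists>w'. w' \<in> lists E \<and> full G w' \<and> w1 \<doteq> Zs gs @ w'"
  proof (rule Cons.IH)
    show "\<forall>h\<in>set gs. cnt (conj_class G h) w1 > N * N + cnt (conj_class G h) (Zs gs)"
    proof
      fix h assume h: "h \<in> set gs"
      then have "cnt (conj_class G h) w = cnt (conj_class G h) (Z g @ w1)"
        using Cons by (intro cnt_eqv[OF w1(3)] conj_class_in) auto
      then show "cnt (conj_class G h) w1 > N * N + cnt (conj_class G h) (Zs gs)"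
        using Cons(5) h by fastforce
    qed
  qed (use Cons w1 in auto)
  then obtain w' where w': "w' \<in> lists E" "full G w'" "w1 \<doteq> Zs gs @ w'" by auto
  have "Z g @ w1 \<doteq> Z g @ (Zs gs @ w')" using w' Cons by (intro eqv_append_left) auto
  then show ?case using eqv_trans[OF w1(3)] w' by auto
qed auto

section \<open>Stability of the number of elements of a given type\<close>

abbreviation cls where "cls w \<equiv> hequiv G E `` {w}"

lemma cls_eq_iff: "u \<in> lists E \<Longrightarrow> v \<in> lists E \<Longrightarrow> cls u = cls v \<longleftrightarrow> u \<doteq> v"
  using eq_equiv_class_iff[OF equiv_hequiv] by (simp add: eqv_def)

lemma wrep_cls: "w \<in> lists E \<Longrightarrow> wrep (cls w) \<doteq> w"
proof -
  assume "w \<in> lists E"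
  then have "w \<in> cls w" using eqv_refl by (auto simp: eqv_def)
  then have "wrep (cls w) \<in> cls w" unfolding wrep_def by (rule someI)
  then show ?thesis using eqv_sym by (auto simp: eqv_def)
qed

lemma FS_wrep: "s \<in> FS G E \<Longrightarrow> wrep s \<in> lists E \<and> cls (wrep s) = s"
proof -
  assume "s \<in> FS G E"
  then obtain w where w: "w \<in> lists E" "s = cls w" by (auto simp: FS_def quotient_def)
  then show ?thesis using wrep_cls[OF w(1)] eqv_lists[OF wrep_cls[OF w(1)]] cls_eq_iff by blast
qed

definition Cl where "Cl = {C \<in> conj_classes G. C \<subseteq> E}"

lemma finite_Cl: "finite Cl"
  by (rule finite_subset[of _ "Pow E"]) (auto simp: Cl_def finE)

lemma conj_class_Cl: "g \<in> E \<Longrightarrow> conj_class G g \<in> Cl"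
  using conj_class_in[of g] by (auto simp: Cl_def conj_class_eq)

text \<open>Every letter lies in its own class, which belongs to \<open>Cl\<close>. Hence a type
  bounds the length, and only the empty word has type zero.\<close>

lemma length_le_cnt: "w \<in> lists E \<Longrightarrow> length w \<le> (\<Sum>C\<in>Cl. cnt C w)"
proof (induction w)
  case (Cons g w)
  have "(1::nat) \<le> (\<Sum>C\<in>Cl. if g \<in> C then 1 else 0)"
    using Cons conj_class_Cl[of g] member_le_sum[of "conj_class G g" Cl "\<lambda>C. if g \<in> C then 1 else 0::nat"]
      finite_Cl by auto
  then show ?case using Cons by (simp add: sum.distrib)
qed auto

definition full_elements where
  "full_elements t = cls ` {w \<in> lists E. full G w \<and> (\<forall>C\<in>Cl. cnt C w = t C)}"

lemma finite_full_elements: "finite (full_elements t)"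
proof -
  have "{w \<in> lists E. full G w \<and> (\<forall>C\<in>Cl. cnt C w = t C)} \<subseteq>
      {w. set w \<subseteq> E \<and> length w \<le> (\<Sum>C\<in>Cl. t C)}"
    using length_le_cnt by fastforce
  then show ?thesis unfolding full_elements_def
    using finite_lists_length_le[OF finE] by (meson finite_imageI finite_subset)
qed

text \<open>Surjectivity of multiplication by \<open>Zs gs\<close> is \<open>extract_Zs\<close>: the
  bound on \<open>t\<close> leaves enough letters in each class of an element of type
  \<open>t'\<close> to split off \<open>Zs gs\<close>.\<close>

lemma full_elements_Zs:
  assumes "gs \<in> lists E" "\<forall>C\<in>Cl. t C > N * N" "\<forall>C\<in>Cl. t' C = t C + cnt C (Zs gs)"
  shows "full_elements t' = (\<lambda>s. cls (Zs gs @ wrep s)) ` full_elements t"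
proof
  show "full_elements t' \<subseteq> (\<lambda>s. cls (Zs gs @ wrep s)) ` full_elements t"
  proof
    fix s assume "s \<in> full_elements t'"
    then obtain w where w: "w \<in> lists E" "full G w" "\<forall>C\<in>Cl. cnt C w = t' C" "s = cls w"
      by (auto simp: full_elements_def)
    have "\<forall>g\<in>set gs. cnt (conj_class G g) w > N * N + cnt (conj_class G g) (Zs gs)"
      using assms w conj_class_Cl by auto
    then obtain w' where w': "w' \<in> lists E" "full G w'" "w \<doteq> Zs gs @ w'"
      using extract_Zs[OF w(1,2) assms(1)] by blast
    have "cnt C w' = t C" if "C \<in> Cl" for C
      using cnt_eqv[OF w'(3), of C] that w assms by (auto simp: Cl_def)
    then have "cls w' \<in> full_elements t" using w' by (auto simp: full_elements_def)
    moreover have "Zs gs @ wrep (cls w') \<doteq> Zs gs @ w'"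
      using assms w' by (intro eqv_append_left wrep_cls) auto
    then have "Zs gs @ wrep (cls w') \<doteq> w" using w'(3) eqv_trans eqv_sym by blast
    then have "s = cls (Zs gs @ wrep (cls w'))"
      using w cls_eq_iff eqv_lists by metis
    ultimately show "s \<in> (\<lambda>s. cls (Zs gs @ wrep s)) ` full_elements t" by blast
  qed
  show "(\<lambda>s. cls (Zs gs @ wrep s)) ` full_elements t \<subseteq> full_elements t'"
  proof
    fix s assume "s \<in> (\<lambda>s. cls (Zs gs @ wrep s)) ` full_elements t"
    then obtain w where w: "w \<in> lists E" "full G w" "\<forall>C\<in>Cl. cnt C w = t C"
        "s = cls (Zs gs @ wrep (cls w))"
      by (auto simp: full_elements_def)
    have "Zs gs @ wrep (cls w) \<doteq> Zs gs @ w"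
      using assms w by (intro eqv_append_left wrep_cls) auto
    then have "s = cls (Zs gs @ w)" using w cls_eq_iff eqv_lists by metis
    moreover have "Zs gs @ w \<in> lists E" using assms w by auto
    moreover have "full G (Zs gs @ w)"
      using calculation(2) by (intro full_superset[OF w(2)]) auto
    ultimately show "s \<in> full_elements t'" unfolding full_elements_def using assms w by auto
  qed
qed

lemma card_full_elements_le:
  assumes "gs \<in> lists E" "\<forall>C\<in>Cl. t C > N * N" "\<forall>C\<in>Cl. t' C = t C + cnt C (Zs gs)"
  shows "card (full_elements t') \<le> card (full_elements t)"
  unfolding full_elements_Zs[OF assms] by (rule card_image_le[OF finite_full_elements])

text \<open>A surjection between finite sets of the same size is injective; applied to
  multiplication by \<open>Zs gs\<close>, this is cancellation.\<close>

lemma cancel_Zs: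
  assumes "gs \<in> lists E" "\<forall>C\<in>Cl. t C > N * N" "\<forall>C\<in>Cl. t' C = t C + cnt C (Zs gs)"
    and card: "card (full_elements t') = card (full_elements t)"
    and w: "w \<in> lists E" "full G w" "\<forall>C\<in>Cl. cnt C w = t C"
    and w': "w' \<in> lists E" "full G w'" "\<forall>C\<in>Cl. cnt C w' = t C"
    and eqv: "Zs gs @ w \<doteq> Zs gs @ w'"
  shows "w \<doteq> w'"
proof -
  let ?f = "\<lambda>s. cls (Zs gs @ wrep s)"
  have inj: "inj_on ?f (full_elements t)"
    using card full_elements_Zs[OF assms(1-3)] finite_full_elements by (metis eq_card_imp_inj_on)
  have f: "?f (cls v) = cls (Zs gs @ v)" if "v \<in> lists E" for v
  proof -
    have "Zs gs @ wrep (cls v) \<doteq> Zs gs @ v"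
      using assms that by (intro eqv_append_left wrep_cls) auto
    then show ?thesis using cls_eq_iff eqv_lists by metis
  qed
  have "?f (cls w) = ?f (cls w')"
    using f w w' eqv cls_eq_iff eqv_lists by metis
  moreover have "cls w \<in> full_elements t" "cls w' \<in> full_elements t" using w w' by (auto simp: full_elements_def)
  ultimately have "cls w = cls w'" using inj by (meson inj_onD)
  then show ?thesis using cls_eq_iff w w' by blast
qed

text \<open>Choose one representative of each class \<open>C\<close> in \<open>D\<close> and repeat
  it \<open>v C\<close> times. Distinct classes are disjoint, so the counts do not
  interfere.\<close>

lemma Zs_of_type:
  assumes "finite D" "D \<subseteq> Cl"
  shows "\<exists>gs\<in>lists E. \<forall>C\<in>Cl. cnt C (Zs gs) = (if C \<in> D then N * v C else 0)"
  using assms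
proof (induction D rule: finite_induct)
  case empty
  show ?case by (rule bexI[of _ "[]"]) auto
next
  case (insert C0 D)
  then obtain gs where gs: "gs \<in> lists E"
      "\<forall>C\<in>Cl. cnt C (Zs gs) = (if C \<in> D then N * v C else 0)" by auto
  have C0: "C0 \<in> conj_classes G" "C0 \<subseteq> E" using insert by (auto simp: Cl_def)
  then obtain g0 where "g0 \<in> carrier G" "C0 = conj_class G g0"
    by (auto simp: conj_classes_def)
  then have "g0 \<in> C0" by simp
  then obtain g where g: "g \<in> C0" ..
  have iff: "g \<in> C \<longleftrightarrow> C = C0" if "C \<in> Cl" for C
  proof
    assume "g \<in> C"
    then have "conj_class G g = C" using that by (intro conj_class_eqI) (auto simp: Cl_def)
    then show "C = C0" using conj_class_eqI[OF C0(1) g] by simp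
  qed (use g in simp)
  have "cnt C (Zs (replicate n g)) = (if C = C0 then N * n else 0)" if "C \<in> Cl" for C n
    using iff[OF that] by (induction n) (auto simp: cnt_Z)
  then have "\<forall>C\<in>Cl. cnt C (Zs (replicate (v C0) g @ gs)) = (if C \<in> insert C0 D then N * v C else 0)"
    using gs insert by auto
  moreover have "replicate (v C0) g @ gs \<in> lists E" using gs g C0 by auto
  ultimately show ?case by blast
qed

text \<open>Prepending \<open>Zs gs\<close> maps the full elements of type \<open>t\<close> onto those of type
  \<open>t + N \<cdot> v\<close>, so the number of elements weakly decreases along each residue class of types
  modulo \<open>N\<close>. It is constant above a minimiser, and there the surjections are injective.\<close>
lemma stability:
  "\<exists>T > N * N. \<forall>gs\<in>lists E. \<forall>w\<in>lists E. \<forall>w'\<in>lists E. full G w \<longrightarrow> full G w' \<longrightarrow>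
     (\<forall>C\<in>Cl. T \<le> cnt C w \<and> cnt C w' = cnt C w) \<longrightarrow> Zs gs @ w \<doteq> Zs gs @ w' \<longrightarrow> w \<doteq> w'"
proof -
  \<comment> \<open>The residues of types modulo \<open>N\<close>, as extensional functions, so that
    there are only finitely many.\<close>
  define R where "R = (Cl \<rightarrow>\<^sub>E {..<N})"
  define P where "P \<rho> t \<longleftrightarrow> (\<forall>C\<in>Cl. N * N < t C \<and> t C mod N = \<rho> C)" for \<rho> t :: "'a set \<Rightarrow> nat"
  \<comment> \<open>A type of residue \<open>\<rho>\<close>, with all entries above
    \<open>N * N\<close>, that admits the fewest full elements.\<close>
  define m where "m \<rho> = arg_min (\<lambda>t. card (full_elements t)) (P \<rho>)" for \<rho>
  have m: "P \<rho> (m \<rho>)" "card (full_elements (m \<rho>)) \<le> card (full_elements t)" if "P \<rho> t" for \<rho> t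
  proof -
    have "P \<rho> (m \<rho>) \<and> (\<forall>t. P \<rho> t \<longrightarrow> card (full_elements (m \<rho>)) \<le> card (full_elements t))"
      unfolding m_def by (rule arg_min_nat_lemma[of "P \<rho>" t "\<lambda>t. card (full_elements t)"]) (rule that)
    then show "P \<rho> (m \<rho>)" "card (full_elements (m \<rho>)) \<le> card (full_elements t)" using that by blast+
  qed
  have finR: "finite R" unfolding R_def by (intro finite_PiE finite_Cl) auto
  \<comment> \<open>Large enough that every type above \<open>T\<close> dominates the chosen
    minimiser of its residue class.\<close>
  define T where "T = Suc (N * N) + (\<Sum>\<rho>\<in>R. \<Sum>C\<in>Cl. m \<rho> C)"
  have mT: "m \<rho> C \<le> T" if "\<rho> \<in> R" "C \<in> Cl" for \<rho> C
  proof -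
    have "m \<rho> C \<le> (\<Sum>C\<in>Cl. m \<rho> C)" using that finite_Cl by (intro member_le_sum) auto
    also have "\<dots> \<le> (\<Sum>\<rho>\<in>R. \<Sum>C\<in>Cl. m \<rho> C)"
      using that finR by (intro member_le_sum[of \<rho> R "\<lambda>\<rho>. \<Sum>C\<in>Cl. m \<rho> C"]) auto
    finally show ?thesis by (simp add: T_def)
  qed
  have "w \<doteq> w'" if gs: "gs \<in> lists E" and w: "w \<in> lists E" "full G w" and w': "w' \<in> lists E" "full G w'"
    and T: "\<forall>C\<in>Cl. T \<le> cnt C w \<and> cnt C w' = cnt C w" and eqv: "Zs gs @ w \<doteq> Zs gs @ w'" for gs w w'
  proof -
    define t where "t C = cnt C w" for C
    define t' where "t' C = t C + cnt C (Zs gs)" for C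
    define \<rho> where "\<rho> = restrict (\<lambda>C. t C mod N) Cl"
    have \<rho>: "\<rho> \<in> R" using N_pos by (auto simp: R_def \<rho>_def)
    have t: "\<forall>C\<in>Cl. N * N < t C" using T by (force simp: t_def T_def)
    have Pt: "P \<rho> t" using t by (auto simp: P_def \<rho>_def)
    have "t' C mod N = t C mod N" for C
      using cnt_Zs_dvd[of C gs] by (auto simp: t'_def mod_add_eq elim!: dvdE)
    then have Pt': "P \<rho> t'" using t by (auto simp: P_def \<rho>_def t'_def intro: trans_less_add1)
    define v where "v C = (t C - m \<rho> C) div N" for C
    have v: "t C = m \<rho> C + N * v C" if "C \<in> Cl" for C
    proof -
      have "m \<rho> C \<le> t C" using mT[OF \<rho> that] T that by (force simp: t_def)
      moreover have "t C mod N = m \<rho> C mod N" using Pt m(1)[OF Pt] that by (auto simp: P_def)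
      ultimately have "N dvd t C - m \<rho> C" by (simp add: mod_eq_dvd_iff_nat)
      then show ?thesis using \<open>m \<rho> C \<le> t C\<close> by (simp add: v_def)
    qed
    obtain hs where hs: "hs \<in> lists E" "\<forall>C\<in>Cl. cnt C (Zs hs) = N * v C"
      using Zs_of_type[of Cl v] finite_Cl by auto
    \<comment> \<open>The type \<open>t\<close> is reached from the minimiser by adding multiples of
      \<open>N\<close>, and \<open>t'\<close> has the same residue. Minimality therefore squeezes
      the two cardinalities together.\<close>
    have "card (full_elements t) \<le> card (full_elements (m \<rho>))"
      using hs v m(1)[OF Pt] by (intro card_full_elements_le[of hs]) (auto simp: P_def)
    also have "\<dots> \<le> card (full_elements t')" using m(2)[OF Pt'] .
    finally have 1: "card (full_elements t) \<le> card (full_elements t')" .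
    have t': "\<forall>C\<in>Cl. t' C = t C + cnt C (Zs gs)" by (simp add: t'_def)
    have "card (full_elements t') = card (full_elements t)" using 1 card_full_elements_le[OF gs t t'] by simp
    from cancel_Zs[OF gs t t' this w _ w' _ eqv] T show ?thesis by (simp add: t_def)
  qed
  moreover have "T > N * N" by (simp add: T_def)
  ultimately show ?thesis by blast
qed

section \<open>The central word containing all letters, and cofactors of letters in it\<close>

definition es where "es = (SOME xs. set xs = E)"

lemma set_es [simp]: "set es = E"
  unfolding es_def using finite_list[OF finE] by (rule someI_ex)

lemma es_lists [simp, intro]: "es \<in> lists E"
  by auto

text \<open>The \<open>k\<close>-th power of the product of all \<open>Z g\<close> with
  \<open>g\<close> in \<open>E\<close>. It is central, and every letter divides
  \<open>Om 1\<close>.\<close>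

definition Om where "Om k = Zs (concat (replicate k es))"

lemma es_power_lists [simp, intro]: "concat (replicate k es) \<in> lists E"
  by (induction k) auto

lemma Om_lists [simp, intro]: "Om k \<in> lists E"
  unfolding Om_def by (intro Zs_lists es_power_lists)

lemma Om_add: "Om (k + l) = Om k @ Om l"
  by (simp add: Om_def replicate_add)

lemma Om_central: "v \<in> lists E \<Longrightarrow> Om k @ v \<doteq> v @ Om k"
  by (intro central) (auto simp: Om_def simp del: in_lists_conv_set)

text \<open>Bring the block \<open>Z g\<close> to the front of \<open>Om 1\<close> and strip one
  \<open>g\<close>. The rest \<open>v\<close> has product \<open>inv g\<close>, so moving
  \<open>g\<close> across \<open>v\<close> conjugates it by \<open>inv g\<close> and leaves it
  unchanged: the same \<open>v\<close> is a cofactor on both sides.\<close>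

lemma Om_cofactor:
  assumes "g \<in> E"
  shows "\<exists>v\<in>lists E. g # v \<doteq> Om 1 \<and> v @ [g] \<doteq> Om 1"
proof -
  have g: "g \<in> set es" using assms by simp
  obtain a b where ab: "es = a @ [g] @ b" using split_list[OF g] by auto
  have l: "a \<in> lists E" "b \<in> lists E" using ab set_es by auto
  obtain n where n: "N = Suc n" using N_pos by (cases N) auto
  define v where "v = replicate n g @ Zs a @ Zs b"
  have v: "v \<in> lists E" using l assms by (simp add: v_def del: in_lists_conv_set) auto
  have "Om 1 = (Zs a @ Z g) @ Zs b" by (simp add: Om_def ab)
  also have "\<dots> \<doteq> (Z g @ Zs a) @ Zs b"
    using l assms by (intro eqv_append_right central) auto
  also have "\<dots> = g # v" by (simp add: v_def Z_def n)
  finally have 1: "g # v \<doteq> Om 1" by (rule eqv_sym)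
  have "wprod G (g # v) = \<one>"
    using wprod_eqv[OF 1] by (simp add: Om_def del: in_lists_conv_set)
  then have "wprod G v = inv g" using assms v
    by (metis carr carr_lists inv_equality inv_inv wprod_closed wprod_simps(2))
  then have "v @ [g] \<doteq> g # v" using move_left[OF v assms] assms by simp
  then show ?thesis using 1 v eqv_trans by blast
qed

section \<open>The group of an equipment as a localization\<close>

abbreviation SW :: "(bool \<times> 'a) list set" where "SW \<equiv> lists (UNIV \<times> E)"

definition peqv (infix "\<frown>" 50) where "u \<frown> v \<longleftrightarrow> (u, v) \<in> pequiv G E"

lemma pstep_lists: "(u, v) \<in> pstep G E \<Longrightarrow> u \<in> SW \<and> v \<in> SW"
proof (induction rule: pstep.induct)
  case (rel u v g h)
  then show ?case using cjE[of "inv h" g] by (auto simp: cj_def)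
qed auto

lemma peqv_iff:
  "u \<frown> v \<longleftrightarrow> (u, v) \<in> (pstep G E \<union> converse (pstep G E))\<^sup>* \<and> u \<in> SW \<and> v \<in> SW"
  unfolding peqv_def pequiv_def by (simp del: in_lists_conv_set)

lemma peqv_lists: "u \<frown> v \<Longrightarrow> u \<in> SW \<and> v \<in> SW"
  by (simp add: peqv_iff)

lemma peqv_refl: "u \<in> SW \<Longrightarrow> u \<frown> u"
  by (simp add: peqv_iff)

lemma peqv_sym: "u \<frown> v \<Longrightarrow> v \<frown> u"
proof -
  have "sym ((pstep G E \<union> converse (pstep G E))\<^sup>*)"
    by (intro sym_rtrancl) (auto simp: sym_def)
  then show "u \<frown> v \<Longrightarrow> v \<frown> u"
    by (simp add: peqv_iff sym_def)
qed

lemma peqv_trans [trans]: "u \<frown> v \<Longrightarrow> v \<frown> w \<Longrightarrow> u \<frown> w"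
  unfolding peqv_iff by (meson rtrancl_trans)

lemma pstep_peqv: "(u, v) \<in> pstep G E \<Longrightarrow> u \<frown> v"
  using pstep_lists[of u v] by (simp add: peqv_iff r_into_rtrancl del: in_lists_conv_set)

lemma equiv_pequiv: "equiv SW (pequiv G E)"
proof (rule equivI)
  show "pequiv G E \<subseteq> SW \<times> SW" unfolding pequiv_def by blast
  show "refl_on SW (pequiv G E)" unfolding refl_on_def pequiv_def by blast
  show "sym (pequiv G E)" using peqv_sym unfolding sym_def peqv_def by blast
  show "trans (pequiv G E)" using peqv_trans unfolding trans_def peqv_def by blast
qed

lemma pstep_cong:
  assumes "(u, v) \<in> pstep G E" "a \<in> SW" "b \<in> SW"
  shows "(a @ u @ b, a @ v @ b) \<in> pstep G E"
  using assms(1)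
proof (cases rule: pstep.cases)
  case (cancel u' v' g c)
  then show ?thesis using pstep.cancel[of "a @ u'" E "v' @ b" g c G] assms by simp
next
  case (rel u' v' g h)
  then show ?thesis using pstep.rel[of "a @ u'" E "v' @ b" g h G] assms by simp
qed

lemma peqv_cong:
  assumes "u \<frown> v" "a \<in> SW" "b \<in> SW"
  shows "a @ u @ b \<frown> a @ v @ b"
proof -
  have "(a @ u @ b, a @ v @ b) \<in> (pstep G E \<union> converse (pstep G E))\<^sup>*"
    using conjunct1[OF assms(1)[unfolded peqv_iff]]
  proof (induction rule: rtrancl_induct)
    case (step y z)
    moreover from step(2) have "(a @ y @ b, a @ z @ b) \<in> pstep G E \<union> converse (pstep G E)"
      using assms(2,3) pstep_cong by blast
    ultimately show ?case by (meson rtrancl_into_rtrancl)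
  qed simp
  then show ?thesis
    using assms by (simp add: peqv_iff)
qed

lemma peqv_append:
  assumes "u \<frown> u'" "v \<frown> v'"
  shows "u @ v \<frown> u' @ v'"
proof -
  have "u @ v \<frown> u' @ v"
    using peqv_cong[OF assms(1), of "[]" v] peqv_lists[OF assms(2)] by simp
  also have "u' @ v \<frown> u' @ v'"
    using peqv_cong[OF assms(2), of u' "[]"] peqv_lists[OF assms(1)] by simp
  finally show ?thesis .
qed

abbreviation pc where "pc u \<equiv> pequiv G E `` {u}"

lemma pc_eq_iff: "u \<in> SW \<Longrightarrow> v \<in> SW \<Longrightarrow> pc u = pc v \<longleftrightarrow> u \<frown> v"
  using eq_equiv_class_iff[OF equiv_pequiv] by (simp add: peqv_def)

lemma pc_eqI: "u \<frown> v \<Longrightarrow> pc u = pc v"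
  unfolding peqv_def by (rule equiv_class_eq[OF equiv_pequiv])

lemma wrep_pc: "u \<in> SW \<Longrightarrow> wrep (pc u) \<frown> u"
proof -
  assume "u \<in> SW"
  then have "u \<in> pc u" using peqv_refl[of u] by (simp add: peqv_def)
  then have "wrep (pc u) \<in> pc u" unfolding wrep_def by (rule someI)
  then show ?thesis using peqv_sym by (simp add: peqv_def)
qed

abbreviation "H \<equiv> hatG G E"

lemma carrier_hatG: "carrier H = pc ` SW"
  unfolding hatG_def by (auto simp: quotient_def)

lemma pc_carrier [intro]: "u \<in> SW \<Longrightarrow> pc u \<in> carrier H"
  unfolding carrier_hatG by (rule imageI)

lemma one_hatG: "\<one>\<^bsub>H\<^esub> = pc []"
  by (simp add: hatG_def)

lemma mult_hatG:
  assumes "u \<in> SW" "v \<in> SW"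
  shows "pc u \<otimes>\<^bsub>H\<^esub> pc v = pc (u @ v)"
proof -
  have "wrep (pc u) @ wrep (pc v) \<frown> u @ v"
    using assms by (intro peqv_append wrep_pc)
  then have "pc (wrep (pc u) @ wrep (pc v)) = pc (u @ v)" by (rule pc_eqI)
  then show ?thesis by (simp add: hatG_def)
qed

lemma cancel_pair: "g \<in> E \<Longrightarrow> [(b, g), (\<not> b, g)] \<frown> []"
  using pstep.cancel[of "[]" E "[]" g b G] by (intro pstep_peqv) simp

lemma inverse_word_lists: "u \<in> SW \<Longrightarrow> rev (map (apfst Not) u) \<in> SW"
  by (induction u) auto

lemma inverse_word:
  "u \<in> SW \<Longrightarrow> rev (map (apfst Not) u) @ u \<frown> []"
proof (induction u)
  case (Cons l u)
  obtain b g where l: "l = (b, g)" by (cases l)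
  have r: "rev (map (apfst Not) u) \<in> SW" using Cons by (intro inverse_word_lists) auto
  \<comment> \<open>The double negation gives the inner pair the form required by
    \<open>cancel_pair\<close>.\<close>
  have "rev (map (apfst Not) u) @ [(\<not> b, g), (\<not> \<not> b, g)] @ u \<frown> rev (map (apfst Not) u) @ [] @ u"
    using Cons r l by (intro peqv_cong cancel_pair) auto
  then show ?case using Cons peqv_trans by (simp add: l)
qed (simp add: peqv_refl)

lemma group_hatG: "group H"
proof (rule groupI)
  show "\<one>\<^bsub>H\<^esub> \<in> carrier H" by (auto simp: one_hatG)
  fix x assume "x \<in> carrier H"
  then obtain u where u: "u \<in> SW" "x = pc u" unfolding carrier_hatG by blast
  have r: "rev (map (apfst Not) u) \<in> SW" using u by (intro inverse_word_lists)
  show "\<one>\<^bsub>H\<^esub> \<otimes>\<^bsub>H\<^esub> x = x" using mult_hatG[of "[]" u] u by (simp add: one_hatG)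
  have "pc (rev (map (apfst Not) u)) \<otimes>\<^bsub>H\<^esub> x = \<one>\<^bsub>H\<^esub>"
    using mult_hatG[OF r u(1)] u inverse_word[OF u(1)] pc_eq_iff[of _ "[]"] peqv_lists
    by (metis one_hatG)
  then show "\<exists>y\<in>carrier H. y \<otimes>\<^bsub>H\<^esub> x = \<one>\<^bsub>H\<^esub>" using r by blast
  fix y assume "y \<in> carrier H"
  then obtain v where v: "v \<in> SW" "y = pc v" unfolding carrier_hatG by blast
  have uv: "u @ v \<in> SW" using u v by auto
  show "x \<otimes>\<^bsub>H\<^esub> y \<in> carrier H" unfolding u v mult_hatG[OF u(1) v(1)] using uv by (rule pc_carrier)
  fix z assume "z \<in> carrier H"
  then obtain w where w: "w \<in> SW" "z = pc w" unfolding carrier_hatG by blast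
  have vw: "v @ w \<in> SW" using v w by auto
  show "x \<otimes>\<^bsub>H\<^esub> y \<otimes>\<^bsub>H\<^esub> z = x \<otimes>\<^bsub>H\<^esub> (y \<otimes>\<^bsub>H\<^esub> z)"
    unfolding u v w mult_hatG[OF u(1) v(1)] mult_hatG[OF v(1) w(1)]
      mult_hatG[OF uv w(1)] mult_hatG[OF u(1) vw] by simp
qed

abbreviation val where "val u \<equiv> wprod G (map (letter_val G) u)"

lemma letter_vals [simp]: "u \<in> SW \<Longrightarrow> map (letter_val G) u \<in> lists (carrier G)"
  by (induction u) (auto simp: letter_val_def)

lemma val_append: "u \<in> SW \<Longrightarrow> v \<in> SW \<Longrightarrow> val (u @ v) = val u \<otimes> val v"
  unfolding map_append by (intro wprod_append letter_vals)

lemma val_append3: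
  assumes "u \<in> SW" "v \<in> SW" "w \<in> SW"
  shows "val (u @ v @ w) = val u \<otimes> (val v \<otimes> val w)"
proof -
  have "v @ w \<in> SW" using assms by auto
  then show ?thesis using val_append[of u "v @ w"] val_append[of v w] assms by metis
qed

lemma val_pstep:
  assumes "(u, v) \<in> pstep G E" shows "val u = val v"
  using assms
proof (cases rule: pstep.cases)
  case (cancel u' v' g b)
  have "val [(b, g), (\<not> b, g)] = \<one>" using cancel by (auto simp: letter_val_def)
  moreover have "val u = val u' \<otimes> (val [(b, g), (\<not> b, g)] \<otimes> val v')"
    unfolding cancel using cancel by (intro val_append3) auto
  moreover have "val v = val u' \<otimes> val v'"
    unfolding cancel using cancel by (intro val_append)
  ultimately show ?thesis using cancel letter_vals[of v'] by simp
next
  case (rel u' v' g h)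
  have "val [(False, h), (True, g), (True, h)] = inv h \<otimes> g \<otimes> h"
    using rel by (auto simp: letter_val_def m_assoc)
  moreover have "val u = val u' \<otimes> (val [(False, h), (True, g), (True, h)] \<otimes> val v')"
    unfolding rel using rel by (intro val_append3) auto
  moreover have "inv h \<otimes> g \<otimes> h \<in> E" using cjE[of "inv h" g] rel by (simp add: cj_def)
  then have "val v = val u' \<otimes> (val [(True, inv h \<otimes> g \<otimes> h)] \<otimes> val v')"
    unfolding rel using rel by (intro val_append3) auto
  ultimately show ?thesis using rel by (auto simp: letter_val_def)
qed

lemma val_peqv: "u \<frown> v \<Longrightarrow> val u = val v"
proof -
  assume "u \<frown> v"
  then have "(u, v) \<in> (pstep G E \<union> converse (pstep G E))\<^sup>*" by (simp add: peqv_iff)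
  then show ?thesis
  proof (induction rule: rtrancl_induct)
    case (step y z)
    then show ?case using val_pstep[of y z] val_pstep[of z y] by auto
  qed simp
qed

lemma betaG_pc: "u \<in> SW \<Longrightarrow> betaG G (pc u) = val u"
  unfolding betaG_def by (intro val_peqv wrep_pc)

lemma betaG_hom: "betaG G \<in> hom H G"
proof (rule homI)
  fix x assume "x \<in> carrier H"
  then obtain u where u: "u \<in> SW" "x = pc u" unfolding carrier_hatG by blast
  show "betaG G x \<in> carrier G"
    unfolding u betaG_pc[OF u(1)] using u by (intro wprod_closed letter_vals)
  fix y assume "y \<in> carrier H"
  then obtain v where v: "v \<in> SW" "y = pc v" unfolding carrier_hatG by blast
  have uv: "u @ v \<in> SW" using u v by auto
  show "betaG G (x \<otimes>\<^bsub>H\<^esub> y) = betaG G x \<otimes> betaG G y"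
    unfolding u v mult_hatG[OF u(1) v(1)] betaG_pc[OF u(1)] betaG_pc[OF v(1)] betaG_pc[OF uv]
    using u v by (intro val_append)
qed

section \<open>Positive words in the group of the equipment\<close>

definition Y where "Y w = pc (map (Pair True) w)"

lemma pos_lists [simp, intro]: "w \<in> lists E \<Longrightarrow> map (Pair True) w \<in> SW"
  by auto

lemma Y_carrier [simp, intro]: "w \<in> lists E \<Longrightarrow> Y w \<in> carrier H"
  unfolding Y_def by (intro pc_carrier pos_lists)

lemma Y_append: "u \<in> lists E \<Longrightarrow> v \<in> lists E \<Longrightarrow> Y (u @ v) = Y u \<otimes>\<^bsub>H\<^esub> Y v"
  unfolding Y_def by (simp add: mult_hatG del: in_lists_conv_set)

lemma betaG_Y: "w \<in> lists E \<Longrightarrow> betaG G (Y w) = wprod G w"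
  unfolding Y_def by (simp add: betaG_pc letter_val_def o_def del: in_lists_conv_set)

text \<open>The defining relation multiplied on the left by the generator of \<open>h\<close>. Thus
  \<open>Y\<close> respects the semigroup relation.\<close>

lemma Y_swap:
  assumes "g \<in> E" "h \<in> E"
  shows "Y [g, h] = Y [h, cj G (inv h) g]"
proof -
  let ?c = "cj G (inv h) g"
  have c: "?c \<in> E" using assms by auto
  have 1: "[(False, h), (True, g), (True, h)] \<frown> [(True, ?c)]"
    using pstep.rel[of "[]" E "[]" g h G] assms by (intro pstep_peqv) (simp add: cj_def)
  have "[(True, h), (\<not> True, h)] @ [(True, g), (True, h)] \<frown> [] @ [(True, g), (True, h)]"
    using assms by (intro peqv_append cancel_pair peqv_refl) auto
  then have "[(True, g), (True, h)] \<frown> [(True, h)] @ [(False, h), (True, g), (True, h)]"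
    by (simp add: peqv_sym)
  also have "[(True, h)] @ [(False, h), (True, g), (True, h)] \<frown> [(True, h)] @ [(True, ?c)]"
    using assms by (intro peqv_append 1 peqv_refl) auto
  finally have "[(True, g), (True, h)] \<frown> [(True, h), (True, ?c)]" by simp
  then show ?thesis unfolding Y_def list.map by (rule pc_eqI)
qed

text \<open>In a commutative target conjugate letters have equal images, so the image of a positive
  word depends on its type only.\<close>

lemma Y_abelian:
  assumes gen: "generate G E = carrier G" and "comm_group K" and hom: "p \<in> hom H K"
    and w: "w \<in> lists E" and w': "w' \<in> lists E" and cnt: "\<forall>C\<in>Cl. cnt C w = cnt C w'"
  shows "p (Y w) = p (Y w')"
proof -
  interpret K: comm_group K by fact
  define q where "q w = p (Y w)" for w
  have q: "q w \<in> carrier K" if "w \<in> lists E" for w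
    unfolding q_def using hom that by (meson Y_carrier hom_in_carrier)
  have qa: "q (u @ v) = q u \<otimes>\<^bsub>K\<^esub> q v" if "u \<in> lists E" "v \<in> lists E" for u v
    unfolding q_def Y_append[OF that] using hom that by (meson Y_carrier hom_mult)
  have letter: "q [cj G h g] = q [g]" if "g \<in> E" "h \<in> E" for g h
  proof -
    have l: "[cj G h g] \<in> lists E" "[h] \<in> lists E" "[g] \<in> lists E" using that by auto
    have "q ([cj G h g] @ [h]) = q ([h] @ [g])"
      using Y_swap[of "cj G h g" h] that by (simp add: q_def)
    then have "q [cj G h g] \<otimes>\<^bsub>K\<^esub> q [h] = q [g] \<otimes>\<^bsub>K\<^esub> q [h]"
      unfolding qa[OF l(1,2)] qa[OF l(2,3)] using q[OF l(2)] q[OF l(3)] by (simp add: K.m_comm)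
    then show ?thesis using q[OF l(1)] q[OF l(2)] q[OF l(3)] by simp
  qed
  \<comment> \<open>The relations give invariance under conjugation by letters only; since
    \<open>E\<close> generates the group, it extends to all conjugators.\<close>
  have "generate G E \<subseteq> {c \<in> carrier G. \<forall>g\<in>E. q [cj G c g] = q [g]}"
    by (rule finite_generate_induct[OF fin]) (auto simp: letter cj_cj[symmetric])
  then have conj: "q [cj G c g] = q [g]" if "g \<in> E" "c \<in> carrier G" for c g
    using gen that by auto
  have "q w = q w'"
    using w w' cnt
  proof (induction w arbitrary: w' rule: list.induct)
    case Nil
    have "length w' \<le> 0" using length_le_cnt[of w'] Nil by simp
    then show ?case by simp
  next
    case (Cons g w)
    let ?C = "conj_class G g"
    have g: "g \<in> E" "w \<in> lists E" using Cons by auto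
    have C: "?C \<in> Cl" "g \<in> ?C" using conj_class_Cl g by auto
    then have "cnt ?C w' \<noteq> 0" using Cons by fastforce
    \<comment> \<open>Equality of types provides a letter of \<open>w'\<close> conjugate to the
      first letter of the other word. Both are deleted for the induction.\<close>
    then obtain g' where g': "g' \<in> set w'" "g' \<in> ?C" using cnt_eq_0[of w' ?C] by auto
    then obtain a b where ab: "w' = a @ [g'] @ b" using split_list by fastforce
    have l: "a \<in> lists E" "b \<in> lists E" "g' \<in> E" using Cons ab by auto
    obtain c where c: "c \<in> carrier G" "g' = cj G c g"
      using conj_classes_transitive[OF _ C(2) g'(2)] C by (auto simp: Cl_def)
    have "q w = q (a @ b)"
    proof (rule Cons.IH)
      show "\<forall>C\<in>Cl. cnt C w = cnt C (a @ b)"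
      proof
        fix C assume D: "C \<in> Cl"
        then have "g' \<in> C \<longleftrightarrow> g \<in> C" using c g by (simp add: Cl_def conj_classes_cj)
        then show "cnt C w = cnt C (a @ b)" using Cons.prems(3) D ab by auto
      qed
    qed (use g l in auto)
    then have "q ([g] @ w) = q [g'] \<otimes>\<^bsub>K\<^esub> (q a \<otimes>\<^bsub>K\<^esub> q b)"
      using qa[of "[g]" w] qa[of a b] conj[OF g(1) c(1)] c l g by simp
    also have "\<dots> = q w'"
      using ab qa[of a "[g'] @ b"] qa[of "[g']" b] q[of a] q[of b] q[of "[g']"] l by (simp add: K.m_lcomm)
    finally show ?case by simp
  qed
  then show ?thesis by (simp add: q_def)
qed

text \<open>Apply \<open>Y_abelian\<close> to the projection onto the quotient by the commutator
  subgroup.\<close>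

lemma Y_derived:
  assumes gen: "generate G E = carrier G"
    and w: "w \<in> lists E" and w': "w' \<in> lists E" and cnt: "\<forall>C\<in>Cl. cnt C w = cnt C w'"
  shows "Y w \<otimes>\<^bsub>H\<^esub> inv\<^bsub>H\<^esub> (Y w') \<in> derived H (carrier H)"
proof -
  interpret H: group H by (rule group_hatG)
  let ?D = "derived H (carrier H)"
  let ?Q = "H Mod ?D"
  interpret D: normal ?D H by (rule H.derived_self_is_normal)
  interpret Q: comm_group ?Q by (rule H.derived_quot_is_comm_group)
  define p where "p x = ?D #>\<^bsub>H\<^esub> x" for x
  have hom: "p \<in> hom H ?Q" unfolding p_def using D.r_coset_hom_Mod .
  have e: "p (Y w) = p (Y w')"
    by (rule Y_abelian[OF gen Q.comm_group_axioms hom w w' cnt])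
  interpret p: group_hom H ?Q p
    by (intro group_hom.intro group_hom_axioms.intro H.group_axioms Q.group_axioms hom)
  have "p (Y w \<otimes>\<^bsub>H\<^esub> inv\<^bsub>H\<^esub> (Y w')) = p (Y w) \<otimes>\<^bsub>?Q\<^esub> inv\<^bsub>?Q\<^esub> p (Y w')"
    using w w' by (metis Y_carrier H.inv_closed p.hom_inv p.hom_mult)
  also have "\<dots> = \<one>\<^bsub>?Q\<^esub>"
    unfolding e using w' by (intro Q.r_inv p.hom_closed Y_carrier)
  finally have "p (Y w \<otimes>\<^bsub>H\<^esub> inv\<^bsub>H\<^esub> (Y w')) = \<one>\<^bsub>?Q\<^esub>" .
  then have "?D #>\<^bsub>H\<^esub> (Y w \<otimes>\<^bsub>H\<^esub> inv\<^bsub>H\<^esub> (Y w')) = ?D" by (simp add: p_def)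
  then show ?thesis
    using w w' H.coset_join1[OF _ _ D.subgroup_axioms] D.subset
    by (simp del: in_lists_conv_set)
qed

text \<open>A signed word is turned into a positive one by replacing the inverse of \<open>g\<close> with a
  cofactor of \<open>g\<close> in the central word \<open>Om 1\<close>; counting the inverse letters keeps track of the
  power of \<open>Om 1\<close> by which one has to divide.\<close>
definition omi where "omi g = (SOME v. v \<in> lists E \<and> g # v \<doteq> Om 1 \<and> v @ [g] \<doteq> Om 1)"

lemma omi: "g \<in> E \<Longrightarrow> omi g \<in> lists E \<and> g # omi g \<doteq> Om 1 \<and> omi g @ [g] \<doteq> Om 1"
  unfolding omi_def by (rule someI_ex) (use Om_cofactor[of g] in \<open>simp add: Bex_def\<close>)

definition pos :: "(bool \<times> 'a) list \<Rightarrow> 'a list" where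
  "pos u = concat (map (\<lambda>(b, g). if b then [g] else omi g) u)"

definition nneg :: "(bool \<times> 'a) list \<Rightarrow> nat" where
  "nneg u = length (filter (Not \<circ> fst) u)"

lemma pos_append [simp]: "pos (u @ v) = pos u @ pos v"
  by (simp add: pos_def)

lemma pos_in_lists [intro]: "u \<in> SW \<Longrightarrow> pos u \<in> lists E"
proof (induction u)
  case (Cons l u)
  obtain b g where l: "l = (b, g)" by (cases l)
  have "pos [l] \<in> lists E"
    using omi[of g] Cons.prems by (cases b) (simp_all add: l pos_def)
  then show ?case using Cons pos_append[of "[l]" u] by auto
qed (simp add: pos_def)

lemma pos_map: "pos (map (Pair True) w) = w" "nneg (map (Pair True) w) = 0"
  by (induction w) (auto simp: pos_def nneg_def)

lemma Om_pull: "a \<in> lists E \<Longrightarrow> b \<in> lists E \<Longrightarrow> a @ Om k @ b \<doteq> Om k @ a @ b"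
  using eqv_append_right[OF eqv_sym[OF Om_central[of a k]], of b] by (simp del: in_lists_conv_set)

text \<open>Either kind of step removes exactly one inverse letter. Its cofactor meets the matching
  letter and leaves one \<open>Om 1\<close>, which is central and moves to the front.\<close>

lemma pos_pstep:
  assumes "(u, v) \<in> pstep G E"
  shows "pos u \<doteq> Om 1 @ pos v \<and> nneg u = nneg v + 1"
  using assms
proof (cases rule: pstep.cases)
  case (cancel u' v' g b)
  have l: "pos u' \<in> lists E" "pos v' \<in> lists E"
    using pos_in_lists[OF cancel(3)] pos_in_lists[OF cancel(4)] .
  have "pos [(b, g), (\<not> b, g)] \<doteq> Om 1"
    using omi[OF cancel(5)] by (cases b) (simp_all add: pos_def)
  then have "pos u' @ pos [(b, g), (\<not> b, g)] @ pos v' \<doteq> pos u' @ Om 1 @ pos v'"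
    using l by (intro eqv_cong)
  also have "\<dots> \<doteq> Om 1 @ pos u' @ pos v'" using l by (intro Om_pull)
  finally have "pos u \<doteq> Om 1 @ pos v" unfolding cancel(1,2) pos_append by simp
  moreover have "nneg u = nneg v + 1" unfolding cancel(1,2) by (simp add: nneg_def)
  ultimately show ?thesis ..
next
  case (rel u' v' g h)
  let ?c = "cj G (inv h) g"
  have l: "pos u' \<in> lists E" "pos v' \<in> lists E" "?c \<in> E" "omi h \<in> lists E"
    using pos_in_lists[OF rel(3)] pos_in_lists[OF rel(4)] omi[OF rel(6)] rel by auto
  have "pos [(False, h), (True, g), (True, h)] = omi h @ [g, h]" by (simp add: pos_def)
  \<comment> \<open>Swapping \<open>g\<close> and \<open>h\<close> puts \<open>h\<close> next to its
    cofactor.\<close>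
  also have "\<dots> \<doteq> omi h @ [h, ?c]"
    using rel l by (intro eqv_append_left swap_right)
  also have "\<dots> = (omi h @ [h]) @ [?c]" by simp
  also have "\<dots> \<doteq> Om 1 @ [?c]"
    using omi[OF rel(6)] l by (intro eqv_append_right) auto
  finally have "pos u' @ pos [(False, h), (True, g), (True, h)] @ pos v' \<doteq> pos u' @ (Om 1 @ [?c]) @ pos v'"
    using l by (intro eqv_cong)
  also have "\<dots> = pos u' @ Om 1 @ ([?c] @ pos v')" by simp
  also have "\<dots> \<doteq> Om 1 @ pos u' @ ([?c] @ pos v')" using l by (intro Om_pull) auto
  finally have "pos u \<doteq> Om 1 @ pos v"
    unfolding rel(1,2) pos_append using rel by (simp add: pos_def cj_def)
  moreover have "nneg u = nneg v + 1" unfolding rel(1,2) by (simp add: nneg_def)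
  ultimately show ?thesis ..
qed

text \<open>A signed word stands for the fraction of \<open>pos u\<close> by
  \<open>Om (nneg u)\<close>. Equality of fractions is written after cross-multiplication, with an
  additional power \<open>Om k\<close> as in the localization of a monoid without assumed
  cancellation.\<close>

lemma pos_peqv:
  assumes "u \<frown> v"
  shows "\<exists>k. Om (k + nneg v) @ pos u \<doteq> Om (k + nneg u) @ pos v"
proof -
  have "\<exists>k. Om (k + nneg v) @ pos u \<doteq> Om (k + nneg u) @ pos v"
    if "(u, v) \<in> (pstep G E \<union> converse (pstep G E))\<^sup>*" "u \<in> SW" for u v
    using that
  proof (induction rule: rtrancl_induct)
    case base
    then show ?case by (intro exI[of _ 0] eqv_refl) (simp add: pos_in_lists del: in_lists_conv_set)
  next
    case (step v w)
    then obtain k where k: "Om (k + nneg v) @ pos u \<doteq> Om (k + nneg u) @ pos v" by blast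
    \<comment> \<open>This form is symmetric in \<open>v\<close> and \<open>w\<close>, so it serves
      steps in both directions.\<close>
    have 1: "Om (nneg w) @ pos v \<doteq> Om (nneg v) @ pos w"
    proof (cases "(v, w) \<in> pstep G E")
      case True
      have p: "pos v \<doteq> Om 1 @ pos w" "nneg v = nneg w + 1" using pos_pstep[OF True] by auto
      have "Om (nneg w) @ pos v \<doteq> Om (nneg w) @ (Om 1 @ pos w)"
        using p by (intro eqv_append_left) auto
      then show ?thesis unfolding p(2) Om_add append_assoc .
    next
      case False
      then have F: "(w, v) \<in> pstep G E" using step by blast
      have p: "pos w \<doteq> Om 1 @ pos v" "nneg w = nneg v + 1" using pos_pstep[OF F] by auto
      have "Om (nneg v) @ pos w \<doteq> Om (nneg v) @ (Om 1 @ pos v)"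
        using p by (intro eqv_append_left) auto
      then show ?thesis unfolding p(2) Om_add append_assoc by (rule eqv_sym)
    qed
    \<comment> \<open>Transitivity of equality of fractions: the denominator of the middle fraction
      is added to the auxiliary exponent.\<close>
    have "Om ((k + nneg v) + nneg w) @ pos u = Om (nneg w) @ (Om (k + nneg v) @ pos u)"
      using Om_add[of "nneg w" "k + nneg v"] by (simp add: add.commute)
    also have "\<dots> \<doteq> Om (nneg w) @ (Om (k + nneg u) @ pos v)"
      using k by (intro eqv_append_left) auto
    also have "\<dots> = Om (k + nneg u) @ (Om (nneg w) @ pos v)"
      using Om_add[of "nneg w" "k + nneg u"] Om_add[of "k + nneg u" "nneg w"]
      by (simp add: add.commute)
    also have "\<dots> \<doteq> Om (k + nneg u) @ (Om (nneg v) @ pos w)"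
      using 1 by (intro eqv_append_left) auto
    also have "\<dots> = Om ((k + nneg v) + nneg u) @ pos w"
      using Om_add[of "k + nneg u" "nneg v"] by (simp add: ac_simps)
    finally show ?case by blast
  qed
  then show ?thesis using assms by (simp add: peqv_iff)
qed

text \<open>Positive words have denominator \<open>Om 0\<close>, so only the auxiliary power
  remains. It is removed later by \<open>stability\<close>.\<close>

lemma Y_eqD:
  assumes "w \<in> lists E" "w' \<in> lists E" "Y w = Y w'"
  shows "\<exists>k. Om k @ w \<doteq> Om k @ w'"
proof -
  have "map (Pair True) w \<frown> map (Pair True) w'"
    using assms pc_eq_iff unfolding Y_def by (metis pos_lists)
  from pos_peqv[OF this] show ?thesis by (simp add: pos_map)
qed

end

section \<open>Prescribing the outer letters\<close>

text \<open>\<open>E\<close> and \<open>E'\<close> are the two equipments, and \<open>F\<close>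
  below consists of the outer letters. All three are closed under conjugation, so each has its own
  semigroup, with prefixes \<open>S\<close>, \<open>S'\<close> and \<open>F\<close>.\<close>

locale conj_pair = S: conj_closed G E + S': conj_closed G E' for G (structure) and E E' +
  assumes E'_sub: "E' \<subseteq> E" and gen: "generate G E' = carrier G"
begin

abbreviation F where "F \<equiv> E - E'"

sublocale F: conj_closed G F
proof unfold_locales
  fix x g assume x: "x \<in> carrier G" and g: "g \<in> F"
  have "cj G x g \<notin> E'"
  proof
    assume "cj G x g \<in> E'"
    then have "cj G (inv x) (cj G x g) \<in> E'" using x by blast
    then show False using x g by simp
  qed
  then show "cj G x g \<in> F" using x g by blast
qed (use S.fin S.sub in auto)

text \<open>Moves over a smaller alphabet are moves over the larger one: the inclusion induces a
  homomorphism of semigroups.\<close>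

lemma hequiv_mono:
  assumes "D \<subseteq> E" shows "hequiv G D \<subseteq> hequiv G E"
proof -
  have "hstep G D \<subseteq> hstep G E"
  proof (rule subrelI)
    fix u v assume "(u, v) \<in> hstep G D"
    then show "(u, v) \<in> hstep G E"
      by (induction rule: hstep.induct)
        (use lists_mono[OF assms] assms in \<open>blast intro: hstep.intros\<close>)+
  qed
  then have "(hstep G D \<union> converse (hstep G D))\<^sup>* \<subseteq> (hstep G E \<union> converse (hstep G E))\<^sup>*"
    by (intro rtrancl_mono) blast
  then show ?thesis using lists_mono[OF assms] unfolding hequiv_def by blast
qed

lemma eqv_inner: "S'.eqv u v \<Longrightarrow> S.eqv u v"
  using hequiv_mono[OF E'_sub] unfolding S'.eqv_def S.eqv_def by blast

lemma eqv_outer: "F.eqv u v \<Longrightarrow> S.eqv u v"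
  using hequiv_mono[of F] unfolding F.eqv_def S.eqv_def by blast

lemma inner_lists: "w \<in> lists E' \<Longrightarrow> w \<in> lists E"
  using E'_sub by auto

lemma outer_lists: "w \<in> lists F \<Longrightarrow> w \<in> lists E"
  by auto

lemma Cl_inner: "C \<in> S'.Cl \<Longrightarrow> C \<in> conj_classes G \<and> C \<subseteq> E'"
  by (simp add: S'.Cl_def)

lemma cnt_outer: "C \<in> S'.Cl \<Longrightarrow> r \<in> lists F \<Longrightarrow> cnt C r = 0"
  using Cl_inner[of C] by (intro cnt_eq_0) auto

text \<open>The threshold at which \<open>extract_Zs\<close> splits off two copies of the central
  word over \<open>E'\<close>.\<close>

definition bound where "bound C = S'.N * S'.N + cnt C (S'.Om 2)"

definition good where
  "good t w \<longleftrightarrow> w \<in> lists E' \<and> full G w \<and> (\<forall>C\<in>S'.Cl. cnt C w = t C)"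

lemma full_Om: "k > 0 \<Longrightarrow> set (S'.Om k) \<subseteq> set w \<Longrightarrow> w \<in> lists E' \<Longrightarrow> full G w"
proof -
  assume "k > 0" "set (S'.Om k) \<subseteq> set w" "w \<in> lists E'"
  moreover from this(1) have "set (S'.Om k) = E'" by (auto simp: S'.Om_def)
  ultimately have "set w = E'" by auto
  then show ?thesis using gen by (simp add: full_def)
qed

text \<open>For an outer letter \<open>h\<close> one has \<open>g h = h\<^sub>1 g = g\<^sub>1 h\<^sub>1\<close> with \<open>h\<^sub>1\<close> the conjugate of \<open>h\<close> by \<open>g\<close>.
  The second factor \<open>Om 1\<close> of \<open>w\<close> supplies the letter \<open>g\<close>, the first one keeps the inner word full.\<close>
lemma conj_outer_letter:
  assumes w: "good t w" and t: "\<forall>C\<in>S'.Cl. bound C < t C" and h: "h \<in> E" and g: "g \<in> E'"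
  shows "\<exists>w'. good t w' \<and> S.eqv (w @ [h]) (w' @ [cj G g h])"
proof -
  have wl: "w \<in> lists E'" "full G w" using w by (auto simp: good_def)
  let ?gs = "concat (replicate 2 S'.es)"
  have "\<forall>g\<in>set ?gs. cnt (conj_class G g) w > S'.N * S'.N + cnt (conj_class G g) (S'.Zs ?gs)"
  proof
    fix g assume "g \<in> set ?gs"
    then have "g \<in> E'" by (auto split: if_splits)
    then have "conj_class G g \<in> S'.Cl" by (rule S'.conj_class_Cl)
    then show "cnt (conj_class G g) w > S'.N * S'.N + cnt (conj_class G g) (S'.Zs ?gs)"
      using w t by (simp add: good_def bound_def S'.Om_def)
  qed
  then obtain w1 where w1: "w1 \<in> lists E'" "S'.eqv w (S'.Om 2 @ w1)"
    using S'.extract_Zs[OF wl S'.es_power_lists] unfolding S'.Om_def by blast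
  \<comment> \<open>Replacing the second \<open>Om 1\<close> by \<open>omi g @ [g]\<close> turns
    \<open>w\<close> into \<open>V @ [g]\<close>.\<close>
  define V where "V = S'.Om 1 @ w1 @ S'.omi g"
  have o: "S'.omi g \<in> lists E'" "S'.eqv (S'.omi g @ [g]) (S'.Om 1)" using S'.omi[OF g] by auto
  have V: "V \<in> lists E'" using w1 o by (simp add: V_def)
  have "S'.Om 2 @ w1 = S'.Om 1 @ (S'.Om 1 @ w1)"
    using S'.Om_add[of 1 1] by (simp add: numeral_2_eq_2)
  also have "S'.eqv \<dots> (S'.Om 1 @ (w1 @ S'.Om 1))"
    using w1 by (intro S'.eqv_append_left S'.Om_central) auto
  also have "S'.eqv \<dots> (S'.Om 1 @ (w1 @ (S'.omi g @ [g])))"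
    using w1 o by (intro S'.eqv_append_left S'.eqv_sym[OF o(2)]) auto
  finally have "S'.eqv w (V @ [g])"
    using S'.eqv_trans[OF w1(2)] by (simp add: V_def)
  then have "S.eqv (w @ [h]) ((V @ [g]) @ [h])"
    using h by (intro S.eqv_append_right eqv_inner) auto
  also have "(V @ [g]) @ [h] = V @ [g, h]" by simp
  also have "S.eqv \<dots> (V @ [cj G g h, g])"
    using V h g E'_sub by (intro S.eqv_append_left S.swap_left) auto
  also have "S.eqv \<dots> (V @ [cj G (cj G g h) g, cj G g h])"
    using V h g E'_sub by (intro S.eqv_append_left S.swap_left) auto
  finally have eqv: "S.eqv (w @ [h]) ((V @ [cj G (cj G g h) g]) @ [cj G g h])" by simp
  let ?w = "V @ [cj G (cj G g h) g]"
  have wl': "?w \<in> lists E'" using V h g by auto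
  have "cnt C ?w = cnt C w" if "C \<in> S'.Cl" for C
  proof -
    have C: "C \<in> conj_classes G" using Cl_inner[OF that] by simp
    have "cj G g h \<in> C \<longleftrightarrow> h \<in> C" using C g h by (intro S.conj_classes_cj) auto
    moreover have "cnt C (w @ [h]) = cnt C (?w @ [cj G g h])" by (rule S.cnt_eqv[OF eqv C])
    ultimately show ?thesis by simp
  qed
  moreover have "full G ?w" using wl' by (intro full_Om[of 1]) (auto simp: V_def)
  ultimately have "good t ?w" using w wl' by (simp add: good_def)
  then show ?thesis using eqv by blast
qed

text \<open>The admissible conjugators contain \<open>E'\<close> and are closed under products. Each
  conjugation changes the inner word, so they are required to work for every good
  \<open>w\<close>.\<close>

lemma conj_outer:
  assumes w: "good t w" and t: "\<forall>C\<in>S'.Cl. bound C < t C" and h: "h \<in> E" and c: "c \<in> carrier G"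
  shows "\<exists>w'. good t w' \<and> S.eqv (w @ [h]) (w' @ [cj G c h])"
proof -
  let ?A = "{c \<in> carrier G. \<forall>w h. good t w \<longrightarrow> h \<in> E \<longrightarrow>
    (\<exists>w'. good t w' \<and> S.eqv (w @ [h]) (w' @ [cj G c h]))}"
  have "generate G E' \<subseteq> ?A"
  proof (rule S.finite_generate_induct[OF S.fin])
    show "E' \<subseteq> ?A" using conj_outer_letter[OF _ t] by auto
    have "S.eqv (w @ [h]) (w @ [cj G \<one> h])" if "good t w" "h \<in> E" for w h
    proof -
      have "w @ [h] \<in> lists E" using that E'_sub by (auto simp: good_def)
      from S.eqv_refl[OF this] show ?thesis using that by simp
    qed
    then show "\<one> \<in> ?A" by blast
    fix x y assume *: "x \<in> ?A" "y \<in> ?A"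
    have "\<exists>w'. good t w' \<and> S.eqv (w @ [h]) (w' @ [cj G (x \<otimes> y) h])"
      if w: "good t w" and h: "h \<in> E" for w h
    proof -
      obtain w1 where w1: "good t w1" "S.eqv (w @ [h]) (w1 @ [cj G y h])" using * w h by blast
      have "cj G y h \<in> E" using * h by blast
      then obtain w2 where w2: "good t w2" "S.eqv (w1 @ [cj G y h]) (w2 @ [cj G x (cj G y h)])"
        using * w1 by blast
      have "cj G x (cj G y h) = cj G (x \<otimes> y) h" using * h by (intro S.cj_cj) auto
      then show ?thesis using w2 S.eqv_trans[OF w1(2)] by metis
    qed
    then show "x \<otimes> y \<in> ?A" using * by blast
  qed blast
  then show ?thesis using gen c w h by blast
qed

text \<open>Fix the letters of \<open>r\<close> from the right. A letter \<open>h\<close> of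
  \<open>v\<close> conjugate to the last letter \<open>a\<close> is brought next to
  \<open>w\<close>, turned into \<open>a\<close> at the expense of \<open>w\<close>, and then pushed
  to the end.\<close>

lemma match_outer:
  assumes "good t w" "\<forall>C\<in>S'.Cl. bound C < t C" "v \<in> lists F" "r \<in> lists F"
    "\<forall>C\<in>F.Cl. cnt C v = cnt C r"
  shows "\<exists>w'. good t w' \<and> S.eqv (w @ v) (w' @ r)"
  using assms
proof (induction r arbitrary: v w rule: rev_induct)
  case Nil
  then have "v = []" using F.length_le_cnt[of v] by simp
  moreover have "w \<in> lists E" using Nil inner_lists by (simp add: good_def)
  ultimately show ?case using Nil(1) by auto
next
  case (snoc a r)
  let ?C = "conj_class G a"
  have a: "a \<in> F" "r \<in> lists F" using snoc by auto
  have C: "?C \<in> F.Cl" "a \<in> ?C" using F.conj_class_Cl[OF a(1)] a by auto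
  then have "cnt ?C v \<noteq> 0" using snoc by fastforce
  then obtain h where h: "h \<in> set v" "h \<in> ?C" using cnt_eq_0[of v ?C] by auto
  then obtain b b' where v: "v = b @ [h] @ b'" using split_list by fastforce
  have hF: "h \<in> F" "b \<in> lists F" "b' \<in> lists F" using snoc v by auto
  define x where "x = map (cj G (inv h)) b @ b'"
  have "F.eqv ((b @ [h]) @ b') ((h # map (cj G (inv h)) b) @ b')"
    using hF by (intro F.eqv_append_right F.pass_left) auto
  then have vx: "F.eqv v ([h] @ x)" by (simp add: v x_def)
  have x: "x \<in> lists F" using F.eqv_lists[OF vx] by auto
  obtain c where c: "c \<in> carrier G" "a = cj G c h"
    using S.conj_classes_transitive[OF _ h(2) C(2)] C by (auto simp: F.Cl_def)
  obtain w1 where w1: "good t w1" "S.eqv (w @ [h]) (w1 @ [a])"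
    using conj_outer[OF snoc.prems(1,2) _ c(1)] hF c by blast
  \<comment> \<open>Pushing \<open>a\<close> to the end conjugates the remaining outer letters,
    which preserves their type.\<close>
  define y where "y = map (cj G a) x"
  have xy: "F.eqv (a # x) (y @ [a])" unfolding y_def using x a by (intro F.pass_right)
  have y: "y \<in> lists F" using F.eqv_lists[OF xy] by auto
  have "cnt C y = cnt C r" if D: "C \<in> F.Cl" for C
  proof -
    have C: "C \<in> conj_classes G" using D by (simp add: F.Cl_def)
    have "a \<in> C \<longleftrightarrow> h \<in> C" unfolding c(2) using C c hF by (intro S.conj_classes_cj) auto
    moreover have "cnt C v = cnt C ([h] @ x)" "cnt C (a # x) = cnt C (y @ [a])"
      using F.cnt_eqv[OF vx C] F.cnt_eqv[OF xy C] by blast+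
    moreover have "cnt C v = cnt C (r @ [a])" using snoc.prems(5) D by blast
    ultimately show ?thesis by simp
  qed
  then obtain w' where w': "good t w'" "S.eqv (w1 @ y) (w' @ r)"
    using snoc.IH[OF w1(1) snoc.prems(2) y a(2)] by blast
  have wl: "w \<in> lists E" "w1 \<in> lists E"
    using snoc.prems(1) w1(1) inner_lists by (simp_all add: good_def del: in_lists_conv_set)
  have "S.eqv (w @ v) (w @ ([h] @ x))"
    using wl vx by (intro S.eqv_append_left eqv_outer)
  also have "w @ ([h] @ x) = (w @ [h]) @ x" by simp
  also have "S.eqv \<dots> ((w1 @ [a]) @ x)"
    using w1 x by (intro S.eqv_append_right outer_lists)
  also have "(w1 @ [a]) @ x = w1 @ (a # x)" by simp
  also have "S.eqv \<dots> (w1 @ (y @ [a]))"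
    using wl xy by (intro S.eqv_append_left eqv_outer)
  also have "w1 @ (y @ [a]) = (w1 @ y) @ [a]" by simp
  also have "S.eqv \<dots> ((w' @ r) @ [a])"
    using w' a by (intro S.eqv_append_right) auto
  finally show ?case using w' by auto
qed

text \<open>Outer letters are pushed right across the inner ones by \<open>move_right\<close>. The
  inner letters stay unchanged and the outer ones are only conjugated.\<close>

lemma split_outer:
  "v \<in> lists E \<Longrightarrow> \<exists>a\<in>lists E'. \<exists>r\<in>lists F. S.eqv v (a @ r)"
proof (induction v)
  case Nil
  show ?case by (intro bexI[of _ "[]"]) auto
next
  case (Cons g v)
  then obtain a r where ar: "a \<in> lists E'" "r \<in> lists F" "S.eqv v (a @ r)" by auto
  have g: "g \<in> E" using Cons by simp
  have 1: "S.eqv ([g] @ v) ([g] @ (a @ r))" using g ar by (intro S.eqv_append_left) auto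
  show ?case
  proof (cases "g \<in> E'")
    case True
    then show ?thesis using 1 ar by (intro bexI[of _ "g # a"] bexI[of _ r]) auto
  next
    case False
    let ?g = "cj G (inv (wprod G a)) g"
    have al: "a \<in> lists E" using ar inner_lists by blast
    have "S.eqv ((g # a) @ r) ((a @ [?g]) @ r)"
      using g al outer_lists[OF ar(2)] by (intro S.eqv_append_right S.move_right)
    then have "S.eqv (g # v) (a @ (?g # r))" using S.eqv_trans[OF 1] by simp
    moreover have "?g \<in> F" using g al False by (intro F.cjE) auto
    ultimately show ?thesis using ar by (intro bexI[of _ a] bexI[of _ "?g # r"]) auto
  qed
qed

text \<open>A copy of \<open>Om 2\<close> over \<open>E'\<close> is split off before sorting the
  letters. It contains all of \<open>E'\<close>, so the inner part generates the group whatever else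
  it contains.\<close>

lemma decompose:
  assumes s: "s \<in> lists E" "full G s" and b: "\<forall>C\<in>S'.Cl. bound C < cnt C s"
  shows "\<exists>w r. good (\<lambda>C. cnt C s) w \<and> r \<in> lists F \<and> S.eqv s (w @ r)"
proof -
  let ?gs = "concat (replicate 2 S'.es)"
  have gs: "?gs \<in> lists E" using inner_lists S'.es_power_lists by blast
  have "\<forall>g\<in>set ?gs. cnt (conj_class G g) s > S'.N * S'.N + cnt (conj_class G g) (S'.Zs ?gs)"
  proof
    fix g assume "g \<in> set ?gs"
    then have "g \<in> E'" by (auto split: if_splits)
    then have "conj_class G g \<in> S'.Cl" by (rule S'.conj_class_Cl)
    then show "cnt (conj_class G g) s > S'.N * S'.N + cnt (conj_class G g) (S'.Zs ?gs)"
      using b by (simp add: bound_def S'.Om_def)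
  qed
  then obtain w1 where w1: "w1 \<in> lists E" "S.eqv s (S'.Om 2 @ w1)"
    using S.extract_Zs[OF s gs] unfolding S'.Om_def by blast
  obtain a r where ar: "a \<in> lists E'" "r \<in> lists F" "S.eqv w1 (a @ r)"
    using split_outer[OF w1(1)] by blast
  have "S.eqv (S'.Om 2 @ w1) (S'.Om 2 @ (a @ r))"
    using ar inner_lists S'.Om_lists by (intro S.eqv_append_left) blast+
  then have eqv: "S.eqv s ((S'.Om 2 @ a) @ r)" using S.eqv_trans[OF w1(2)] by simp
  have l: "S'.Om 2 @ a \<in> lists E'" using ar by auto
  have "cnt C (S'.Om 2 @ a) = cnt C s" if "C \<in> S'.Cl" for C
    using S.cnt_eqv[OF eqv, of C] Cl_inner[OF that] cnt_outer[OF that ar(2)] by simp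
  then have "good (\<lambda>C. cnt C s) (S'.Om 2 @ a)"
    using l full_Om[of 2 "S'.Om 2 @ a"] by (simp add: good_def del: in_lists_conv_set)
  then show ?thesis using eqv ar by blast
qed

text \<open>After decomposition the outer part has the type of \<open>r\<close>, and
  \<open>match_outer\<close> makes it equal to \<open>r\<close>. All elements of one type thus share
  the same outer part.\<close>

lemma normal_form:
  assumes s: "s \<in> lists E" "full G s" and b: "\<forall>C\<in>S'.Cl. bound C < t C"
    and r: "r \<in> lists F" and w: "good t w"
    and cnt: "\<forall>C\<in>S.Cl. cnt C s = cnt C (w @ r)"
  shows "\<exists>w'. good t w' \<and> S.eqv s (w' @ r)"
proof -
  have t: "cnt C s = t C" if "C \<in> S'.Cl" for C
  proof -
    have "C \<in> S.Cl" using Cl_inner[OF that] E'_sub by (auto simp: S.Cl_def)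
    then show ?thesis using cnt cnt_outer[OF that r] w that by (simp add: good_def)
  qed
  obtain u v where uv: "good (\<lambda>C. cnt C s) u" "v \<in> lists F" "S.eqv s (u @ v)"
    using decompose[OF s] b t by auto
  have u: "good t u" using uv(1) t by (simp add: good_def)
  have "cnt C v = cnt C r" if "C \<in> F.Cl" for C
  proof -
    have C: "C \<in> conj_classes G" "C \<subseteq> F" "C \<in> S.Cl" using that by (auto simp: F.Cl_def S.Cl_def)
    have "cnt C u = 0" "cnt C w = 0"
      using C u w by (intro cnt_eq_0; auto simp: good_def)+
    moreover have "cnt C s = cnt C (u @ v)" using S.cnt_eqv[OF uv(3) C(1)] .
    ultimately show ?thesis using cnt C by simp
  qed
  then obtain w' where "good t w'" "S.eqv (u @ v) (w' @ r)"
    using match_outer[OF u b uv(2) r] by blast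
  then show ?thesis using S.eqv_trans[OF uv(3)] by blast
qed

section \<open>Counting the elements by an injection into the ambiguity set\<close>

lemma ambiguity_bound:
  "\<exists>T. \<forall>s1 \<in> FS_full G E. (\<forall>C \<in> conj_classes G. C \<subseteq> E' \<longrightarrow> T \<le> tau s1 C) \<longrightarrow>
     finite (amb_set G E') \<longrightarrow>
     card {s \<in> FS_full G E. (\<forall>C \<in> conj_classes G. C \<subseteq> E \<longrightarrow> tau s C = tau s1 C)
         \<and> alphaG G s = alphaG G s1} \<le> card (amb_set G E')"
proof -
  obtain T0 where T0: "\<And>gs w w'. gs \<in> lists E' \<Longrightarrow> w \<in> lists E' \<Longrightarrow> w' \<in> lists E' \<Longrightarrow>
      full G w \<Longrightarrow> full G w' \<Longrightarrow> (\<forall>C\<in>S'.Cl. T0 \<le> cnt C w \<and> cnt C w' = cnt C w) \<Longrightarrow>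
      S'.eqv (S'.Zs gs @ w) (S'.Zs gs @ w') \<Longrightarrow> S'.eqv w w'"
    using S'.stability by blast
  \<comment> \<open>\<open>T0\<close> permits cancelling powers of the central word and
    \<open>bound\<close> permits the normal form. The successor makes the second inequality
    strict.\<close>
  define T where "T = Suc (T0 + (\<Sum>C\<in>S'.Cl. bound C))"
  have T: "T0 \<le> T" "bound C < T" if "C \<in> S'.Cl" for C
    using member_le_sum[of C S'.Cl bound] S'.finite_Cl that by (auto simp: T_def)
  interpret H: group "hatG G E'" by (rule S'.group_hatG)
  interpret beta: group_hom "hatG G E'" G "betaG G"
    by (intro group_hom.intro group_hom_axioms.intro H.group_axioms S.group_axioms S'.betaG_hom)
  have FS: "wrep s \<in> lists E \<and> full G (wrep s) \<and> S.cls (wrep s) = s" if "s \<in> FS_full G E" for s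
    using that S.FS_wrep[of s] by (simp add: FS_full_def Gs_def full_def)
  show ?thesis
  proof (rule exI[of _ T], intro ballI impI)
    fix s1 assume s1: "s1 \<in> FS_full G E" and big: "\<forall>C\<in>conj_classes G. C \<subseteq> E' \<longrightarrow> T \<le> tau s1 C"
      and fin: "finite (amb_set G E')"
    let ?A = "{s \<in> FS_full G E. (\<forall>C \<in> conj_classes G. C \<subseteq> E \<longrightarrow> tau s C = tau s1 C)
         \<and> alphaG G s = alphaG G s1}"
    have tau: "tau s C = cnt C (wrep s)" for s C by (simp add: tau_def cnt_def)
    define t where "t C = cnt C (wrep s1)" for C
    have t: "T \<le> t C" if "C \<in> S'.Cl" for C
      using big Cl_inner[OF that] by (auto simp: t_def tau)
    then have b: "\<forall>C\<in>S'.Cl. bound C < t C" using T by fastforce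
    obtain w1 r where w1: "good t w1" "r \<in> lists F" "S.eqv (wrep s1) (w1 @ r)"
      using decompose[of "wrep s1"] FS[OF s1] b unfolding t_def by auto
    have "\<exists>w. good t w \<and> S.eqv (wrep s) (w @ r)" if s: "s \<in> ?A" for s
    proof (rule normal_form[OF _ _ b w1(2,1)])
      show "\<forall>C\<in>S.Cl. cnt C (wrep s) = cnt C (w1 @ r)"
        using s S.cnt_eqv[OF w1(3)] by (simp add: S.Cl_def tau)
    qed (use FS s in blast)+
    \<comment> \<open>Choose for every counted element \<open>s\<close> an inner word
      \<open>f s\<close>, all with the outer part \<open>r\<close> of \<open>s1\<close>.\<close>
    then have "\<exists>f. \<forall>s\<in>?A. good t (f s) \<and> S.eqv (wrep s) (f s @ r)"
      by (intro bchoice ballI)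
    then obtain f where f: "\<And>s. s \<in> ?A \<Longrightarrow> good t (f s) \<and> S.eqv (wrep s) (f s @ r)" by blast
    have fl: "f s \<in> lists E'" if "s \<in> ?A" for s using f[OF that] by (simp add: good_def)
    have w1l: "w1 \<in> lists E'" using w1 by (simp add: good_def)
    \<comment> \<open>The products of the whole words agree, and the common factor from
      \<open>r\<close> cancels in the group.\<close>
    have wp: "wprod G (f s) = wprod G w1" if s: "s \<in> ?A" for s
    proof -
      have l: "f s \<in> lists (carrier G)" "w1 \<in> lists (carrier G)" "r \<in> lists (carrier G)"
        using fl[OF s] w1l w1(2) by blast+
      have "wprod G (f s @ r) = wprod G (w1 @ r)"
        using s S.wprod_eqv[OF w1(3)] S.wprod_eqv[of "wrep s" "f s @ r"] f[OF s]
        by (simp add: alphaG_def)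
      then show ?thesis
        unfolding S.wprod_append[OF l(1,3)] S.wprod_append[OF l(2,3)]
        using S.wprod_closed[OF l(1)] S.wprod_closed[OF l(2)] S.wprod_closed[OF l(3)] by simp
    qed
    \<comment> \<open>The injection. Equal products put its values in the kernel of
      \<open>betaG G\<close>, equal types put them in the commutator subgroup.\<close>
    define \<phi> where "\<phi> s = S'.Y (f s) \<otimes>\<^bsub>hatG G E'\<^esub> inv\<^bsub>hatG G E'\<^esub> (S'.Y w1)" for s
    have "\<phi> s \<in> amb_set G E'" if s: "s \<in> ?A" for s
    proof -
      have c: "S'.Y (f s) \<in> carrier (hatG G E')" "S'.Y w1 \<in> carrier (hatG G E')"
        using S'.Y_carrier[OF fl[OF s]] S'.Y_carrier[OF w1l] .
      have "betaG G (\<phi> s) = wprod G (f s) \<otimes> inv (wprod G w1)"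
        unfolding \<phi>_def beta.hom_mult[OF c(1) H.inv_closed[OF c(2)]] beta.hom_inv[OF c(2)]
        using S'.betaG_Y[OF fl[OF s]] S'.betaG_Y[OF w1l] by simp
      also have "\<dots> = \<one>"
        unfolding wp[OF s] using w1l by (intro S.r_inv S.wprod_closed) auto
      finally have "betaG G (\<phi> s) = \<one>" .
      moreover have "\<phi> s \<in> derived (hatG G E') (carrier (hatG G E'))"
        unfolding \<phi>_def using f[OF s] w1(1)
        by (intro S'.Y_derived[OF gen fl[OF s] w1l]) (simp add: good_def)
      ultimately show ?thesis by (simp add: amb_set_def)
    qed
    then have sub: "\<phi> ` ?A \<subseteq> amb_set G E'" by blast
    have inj: "inj_on \<phi> ?A"
    proof (rule inj_onI)
      fix s s' assume s: "s \<in> ?A" and s': "s' \<in> ?A" and eq: "\<phi> s = \<phi> s'"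
      have "S'.Y (f s) = S'.Y (f s')"
        using eq H.right_cancel[OF H.inv_closed[OF S'.Y_carrier[OF w1l]]
            S'.Y_carrier[OF fl[OF s]] S'.Y_carrier[OF fl[OF s']]]
        unfolding \<phi>_def by blast
      \<comment> \<open>Equal images make the inner words equal up to a power of the central word.
        Their types are large enough for this power to be cancelled.\<close>
      then obtain k where "S'.eqv (S'.Om k @ f s) (S'.Om k @ f s')"
        using S'.Y_eqD[OF fl[OF s] fl[OF s']] by blast
      then have "S'.eqv (f s) (f s')"
        unfolding S'.Om_def using f[OF s] f[OF s'] t T(1)
        by (intro T0[OF S'.es_power_lists fl[OF s] fl[OF s']]) (force simp: good_def)+
      then have "S.eqv (f s @ r) (f s' @ r)"
        using w1(2) by (intro S.eqv_append_right eqv_inner outer_lists)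
      then have "S.eqv (wrep s) (wrep s')"
        using f[OF s] f[OF s'] S.eqv_trans S.eqv_sym by blast
      then have "S.cls (wrep s) = S.cls (wrep s')"
        using S.cls_eq_iff S.eqv_lists by blast
      then show "s = s'" using FS s s' by blast
    qed
    show "card ?A \<le> card (amb_set G E')" by (rule card_inj_on_le[OF inj sub fin])
  qed
qed

end

lemma (in group) equipment_conj_closed:
  assumes "finite (carrier G)" "equipment G E"
  shows "conj_closed G E"
proof unfold_locales
  fix x g assume x: "x \<in> carrier G" and "g \<in> E"
  then obtain C where "C \<in> conj_classes G" "g \<in> C" "C \<subseteq> E"
    using assms(2) unfolding equipment_def by blast
  then show "cj G x g \<in> E" using conj_classes_cj[of C x g] conj_classes_sub[of C] x by blast
qed (use assms in \<open>auto simp: equipment_def\<close>)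

theorem theorem4p3:
  fixes G :: "('a, 'b) monoid_scheme" and E E' :: "'a set"
  assumes "group G" and "finite (carrier G)"
    and "equipment G E" and "equipment G E'" and "E' \<subseteq> E"
    and "generate G E' = carrier G"
  shows "\<exists>T::nat. \<forall>s1 \<in> FS_full G E.
           (\<forall>C \<in> conj_classes G. C \<subseteq> E' \<longrightarrow> T \<le> tau s1 C) \<longrightarrow>
           (finite (amb_set G E') \<longrightarrow>
              card {s \<in> FS_full G E. (\<forall>C \<in> conj_classes G. C \<subseteq> E \<longrightarrow> tau s C = tau s1 C)
                                   \<and> alphaG G s = alphaG G s1}
              \<le> card (amb_set G E'))"
proof -
  interpret conj_pair G E E'
    using assms group.equipment_conj_closed[of G]
    by (simp add: conj_pair_def conj_pair_axioms_def)
  show ?thesis by (rule ambiguity_bound)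
qed

end
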